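(* Let $\mathcal A$ and $\mathfrak A$ be commutative Banach algebras such that $\mathcal A$ is a symmetric Banach $\mathfrak A$-bimodule with compatible actions (so that $\mathcal A\rtimes\mathfrak A$ is commutative). Then: (i) $\mathcal A\rtimes\mathfrak A$ is semisimple if and only if both $\mathcal A$ and $\mathfrak A$ are semisimple. (ii) $\mathcal A\rtimes\mathfrak A$ is regular if and only if both $\mathcal A$ and $\mathfrak A$ are regular.
   Context: The actions of $\mathfrak A$ on $\mathcal A$ are compatible if for all $a,b\in\mathcal A$ and $\beta\in\mathfrak A$: $\beta\cdot(ab)=(\beta\cdot a)b$, $(ab)\cdot\beta=a(b\cdot\beta)$, $a(\beta\cdot b)=(a\cdot\beta)b$; the bimodule is symmetric if $\beta\cdot a=a\cdot\beta$ for all $a,\beta$. The amalgamated duplication $\mathcal A\rtimes\mathfrak A$ is $\mathcal A\times\mathfrak A$ with product $(a,\beta)(b,\gamma)=(ab+a\cdot\gamma+\beta\cdot b,\ \beta\gamma)$ and norm $\|(a,\beta)\|=\|a\|+\|\beta\|$. For a commutative Banach algebra $\mathcal C$, $\sigma(\mathcal C)$ is the set of non-zero multiplicative linear functionals (with its Gelfand topology). $\mathcal C$ is semisimple if the Gelfand homomorphism $\mathcal C\to C_0(\sigma(\mathcal C))$, $c\mapsto\hat c$, $\hat c(\varphi)=\varphi(c)$, is injective. $\mathcal C$ is regular if for each closed $E\subseteq\sigma(\mathcal C)$ and $\varphi_0\in\sigma(\mathcal C)\setminus E$ there exists $c\in\mathcal C$ with $\varphi_0(c)\ne0$ and $\varphi(c)=0$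 for all $\varphi\in E$. *)

theory Defs
  imports "HOL-Analysis.Analysis"
begin

section \<open>Complex Banach algebras\<close>

text \<open>
  The amalgamated duplication depends on the module actions, which are terms, so its product
  cannot be a type class instance on a pair type.  Algebra structures are therefore records over
  a type that supplies the elements and the additive group; the product type
  \<open>'a \<times> 'b\<close> carries componentwise addition, but the norm used on it below is not the
  Euclidean one of the library.  No unit element is assumed.
\<close>

record 'a alg =
  smul :: "complex \<Rightarrow> 'a \<Rightarrow> 'a"
  mul :: "'a \<Rightarrow> 'a \<Rightarrow> 'a"
  nrm :: "'a \<Rightarrow> real"

locale complex_banach_space = vector_space "smul A"
  for A :: "'a::ab_group_add alg" +
  assumes nrm_zero_iff: "nrm A x = 0 \<longleftrightarrow> x = 0"
    and nrm_triangle: "nrm A (x + y) \<le> nrm A x + nrm A y"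
    and nrm_smul: "nrm A (smul A c x) = cmod c * nrm A x"
    and complete: "Metric_space.mcomplete UNIV (\<lambda>x y. nrm A (x - y))"

locale complex_banach_algebra = complex_banach_space A
  for A :: "'a::ab_group_add alg" +
  assumes mul_assoc: "mul A (mul A x y) z = mul A x (mul A y z)"
    and mul_linear_right: "Vector_Spaces.linear (smul A) (smul A) (\<lambda>y. mul A x y)"
    and mul_linear_left: "Vector_Spaces.linear (smul A) (smul A) (\<lambda>x. mul A x y)"
    and nrm_mul: "nrm A (mul A x y) \<le> nrm A x * nrm A y"

locale comm_banach_algebra = complex_banach_algebra A
  for A :: "'a::ab_group_add alg" +
  assumes mul_commute: "mul A x y = mul A y x"


section \<open>Banach bimodules and compatible actions\<close>

text \<open>
  The module is the Banach space underlying \<open>A\<close>; \<open>mul A\<close> plays no role in this locale.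
  The constant in the two norm estimates is \<open>1\<close>, which is exactly what submultiplicativity of
  the norm of the duplication requires: apply it to \<open>(0, b) (a, 0)\<close> and \<open>(a, 0) (0, b)\<close>.
\<close>

locale banach_bimodule = A: complex_banach_space A + B: complex_banach_algebra B
  for A :: "'a::ab_group_add alg" and B :: "'b::ab_group_add alg"
    and lact :: "'b \<Rightarrow> 'a \<Rightarrow> 'a" and ract :: "'a \<Rightarrow> 'b \<Rightarrow> 'a" +
  assumes lact_linear_right: "Vector_Spaces.linear (smul A) (smul A) (\<lambda>a. lact b a)"
    and lact_linear_left: "Vector_Spaces.linear (smul B) (smul A) (\<lambda>b. lact b a)"
    and ract_linear_right: "Vector_Spaces.linear (smul B) (smul A) (\<lambda>b. ract a b)"
    and ract_linear_left: "Vector_Spaces.linear (smul A) (smul A) (\<lambda>a. ract a b)"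
    and lact_mul: "lact (mul B b c) a = lact b (lact c a)"
    and ract_mul: "ract a (mul B b c) = ract (ract a b) c"
    and lact_ract: "ract (lact b a) c = lact b (ract a c)"
    and nrm_lact: "nrm A (lact b a) \<le> nrm B b * nrm A a"
    and nrm_ract: "nrm A (ract a b) \<le> nrm A a * nrm B b"

definition symmetric_actions :: "('b \<Rightarrow> 'a \<Rightarrow> 'a) \<Rightarrow> ('a \<Rightarrow> 'b \<Rightarrow> 'a) \<Rightarrow> bool"
  where "symmetric_actions lact ract \<longleftrightarrow> (\<forall>b a. lact b a = ract a b)"

definition compatible_actions ::
    "'a alg \<Rightarrow> ('b \<Rightarrow> 'a \<Rightarrow> 'a) \<Rightarrow> ('a \<Rightarrow> 'b \<Rightarrow> 'a) \<Rightarrow> bool"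
  where "compatible_actions A lact ract \<longleftrightarrow>
    (\<forall>a a' b. lact b (mul A a a') = mul A (lact b a) a' \<and>
              ract (mul A a a') b = mul A a (ract a' b) \<and>
              mul A a (lact b a') = mul A (ract a b) a')"

definition duplication ::
    "'a::ab_group_add alg \<Rightarrow> 'b::ab_group_add alg \<Rightarrow>
     ('b \<Rightarrow> 'a \<Rightarrow> 'a) \<Rightarrow> ('a \<Rightarrow> 'b \<Rightarrow> 'a) \<Rightarrow> ('a \<times> 'b) alg"
  where "duplication A B lact ract =
    \<lparr> smul = (\<lambda>c (a, b). (smul A c a, smul B c b)),
      mul = (\<lambda>(a, b) (a', b'). (mul A a a' + ract a b' + lact b a', mul B b b')),
      nrm = (\<lambda>(a, b). nrm A a + nrm B b) \<rparr>"


section \<open>Gelfand theory\<close>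

definition spectrum :: "'a::ab_group_add alg \<Rightarrow> ('a \<Rightarrow> complex) set"
  where "spectrum C = {\<phi>. Vector_Spaces.linear (smul C) (*) \<phi> \<and>
    (\<forall>x y. \<phi> (mul C x y) = \<phi> x * \<phi> y) \<and> \<phi> \<noteq> (\<lambda>_. 0)}"

text \<open>
  The topology of the library on \<open>'a \<Rightarrow> complex\<close> is the product topology, that is, pointwise
  convergence; its trace on the spectrum is the Gelfand (weak-star) topology.
\<close>

definition gelfand_topology :: "'a::ab_group_add alg \<Rightarrow> ('a \<Rightarrow> complex) topology"
  where "gelfand_topology C = top_of_set (spectrum C)"

text \<open>
  Gelfand transforms are functions on the spectrum only, hence the \<open>restrict\<close>.  Whether the
  Gelfand homomorphism is injective does not depend on the space of functions chosen as its
  codomain.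
\<close>

definition gelfand :: "'a::ab_group_add alg \<Rightarrow> 'a \<Rightarrow> (('a \<Rightarrow> complex) \<Rightarrow> complex)"
  where "gelfand C c = restrict (\<lambda>\<phi>. \<phi> c) (spectrum C)"

definition semisimple :: "'a::ab_group_add alg \<Rightarrow> bool"
  where "semisimple C \<longleftrightarrow> inj (gelfand C)"

definition regular :: "'a::ab_group_add alg \<Rightarrow> bool"
  where "regular C \<longleftrightarrow>
    (\<forall>E \<phi>0. closedin (gelfand_topology C) E \<and> \<phi>0 \<in> spectrum C - E \<longrightarrow>
      (\<exists>c. \<phi>0 c \<noteq> 0 \<and> (\<forall>\<phi>\<in>E. \<phi> c = 0)))"


section \<open>The duplication is a commutative Banach algebra\<close>

context complex_banach_space
begin

lemma nrm_0 [simp]: "nrm A 0 = 0"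
  by (simp add: nrm_zero_iff)

lemma nrm_uminus: "nrm A (- x) = nrm A x"
  using nrm_smul[of "-1" x] by simp

lemma nrm_nonneg: "0 \<le> nrm A x"
  using nrm_triangle[of x "- x"] by (simp add: nrm_uminus)

lemma nrm_metric: "Metric_space UNIV (\<lambda>x y. nrm A (x - y))"
proof
  show "nrm A (x - y) = nrm A (y - x)" for x y
    using nrm_uminus[of "x - y"] by simp
  show "nrm A (x - z) \<le> nrm A (x - y) + nrm A (y - z)" for x y z
    using nrm_triangle[of "x - y" "y - z"] by simp
qed (auto simp: nrm_nonneg nrm_zero_iff)

lemma nrm_complete:
  fixes s :: "nat \<Rightarrow> 'a"
  assumes "\<And>e. e > 0 \<Longrightarrow> \<exists>N. \<forall>m\<ge>N. \<forall>n\<ge>N. nrm A (s m - s n) < e"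
  shows "\<exists>l. \<forall>e>0. \<exists>N. \<forall>n\<ge>N. nrm A (s n - l) < e"
proof -
  interpret M: Metric_space UNIV "\<lambda>x y. nrm A (x - y)" by (rule nrm_metric)
  have "M.MCauchy s" unfolding M.MCauchy_def
  proof (intro conjI allI impI)
    fix e :: real assume "e > 0"
    from assms[OF this] show "\<exists>N. \<forall>n n'. N \<le> n \<longrightarrow> N \<le> n' \<longrightarrow> nrm A (s n - s n') < e"
      by blast
  qed simp
  then show ?thesis
    using complete unfolding M.mcomplete_def M.limit_metric_sequentially by simp
qed

end

lemma complex_banach_space_duplication:
  assumes "complex_banach_space A" and "complex_banach_space B"
  shows "complex_banach_space (duplication A B lact ract)" (is "complex_banach_space ?D")
proof -
  interpret A: complex_banach_space A by fact
  interpret B: complex_banach_space B by fact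
  have sm: "smul ?D c p = (smul A c (fst p), smul B c (snd p))" for c p
    by (simp add: duplication_def split: prod.split)
  have nm: "nrm ?D p = nrm A (fst p) + nrm B (snd p)" for p
    by (simp add: duplication_def split: prod.split)
  interpret vector_space "smul ?D"
    by unfold_locales
      (auto simp: sm A.scale_right_distrib A.scale_left_distrib
        B.scale_right_distrib B.scale_left_distrib)
  have z: "nrm ?D x = 0 \<longleftrightarrow> x = 0" for x
    using A.nrm_nonneg[of "fst x"] B.nrm_nonneg[of "snd x"]
    by (auto simp: nm add_nonneg_eq_0_iff A.nrm_zero_iff B.nrm_zero_iff prod_eq_iff)
  have t: "nrm ?D (x + y) \<le> nrm ?D x + nrm ?D y" for x y
    using A.nrm_triangle[of "fst x" "fst y"] B.nrm_triangle[of "snd x" "snd y"] by (simp add: nm)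
  have sc: "nrm ?D (smul ?D c x) = cmod c * nrm ?D x" for c x
    by (simp add: nm sm A.nrm_smul B.nrm_smul distrib_left)
  have um: "nrm ?D (- x) = nrm ?D x" for x
    by (simp add: nm A.nrm_uminus B.nrm_uminus)
  interpret M: Metric_space UNIV "\<lambda>x y. nrm ?D (x - y)"
  proof
    show "nrm ?D (x - y) = nrm ?D (y - x)" for x y
      using um[of "x - y"] by simp
    show "nrm ?D (x - z) \<le> nrm ?D (x - y) + nrm ?D (y - z)" for x y z
      using t[of "x - y" "y - z"] by simp
    show "0 \<le> nrm ?D (x - y)" for x y
      by (simp add: nm A.nrm_nonneg B.nrm_nonneg)
  qed (simp add: z)
  have "M.mcomplete"
    unfolding M.mcomplete_def M.limit_metric_sequentially
  proof (intro allI impI)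
    fix s assume "M.MCauchy s"
    then have C: "\<exists>N. \<forall>m\<ge>N. \<forall>n\<ge>N. nrm ?D (s m - s n) < e" if "e > 0" for e
      using that unfolding M.MCauchy_def by meson
    have a: "nrm A (fst x) \<le> nrm ?D x" and b: "nrm B (snd x) \<le> nrm ?D x" for x
      by (simp_all add: nm A.nrm_nonneg B.nrm_nonneg)
    have "\<exists>N. \<forall>m\<ge>N. \<forall>n\<ge>N. nrm A (fst (s m) - fst (s n)) < e" if "e > 0" for e
      using C[OF that] a by (metis fst_diff le_less_trans)
    from A.nrm_complete[OF this]
    obtain l where l: "\<And>e. e > 0 \<Longrightarrow> \<exists>N. \<forall>n\<ge>N. nrm A (fst (s n) - l) < e" by blast
    have "\<exists>N. \<forall>m\<ge>N. \<forall>n\<ge>N. nrm B (snd (s m) - snd (s n)) < e" if "e > 0" for e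
      using C[OF that] b by (metis snd_diff le_less_trans)
    from B.nrm_complete[OF this]
    obtain k where k: "\<And>e. e > 0 \<Longrightarrow> \<exists>N. \<forall>n\<ge>N. nrm B (snd (s n) - k) < e" by blast
    have "\<exists>N. \<forall>n\<ge>N. nrm ?D (s n - (l, k)) < e" if epos: "e > 0" for e
    proof -
      obtain N1 where N1: "\<forall>n\<ge>N1. nrm A (fst (s n) - l) < e / 2" using l half_gt_zero[OF epos] by blast
      obtain N2 where N2: "\<forall>n\<ge>N2. nrm B (snd (s n) - k) < e / 2" using k half_gt_zero[OF epos] by blast
      have "nrm ?D (s n - (l, k)) < e" if "n \<ge> max N1 N2" for n
        using N1[rule_format, of n] N2[rule_format, of n] that by (simp add: nm)
      then show ?thesis by blast
    qed
    then show "\<exists>x. x \<in> UNIV \<and> (\<forall>e>0. \<exists>N. \<forall>n\<ge>N. s n \<in> UNIV \<and> nrm ?D (s n - x) < e)"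
      by blast
  qed
  with z t sc show ?thesis by unfold_locales
qed

lemma comm_banach_algebra_duplication:
  assumes "comm_banach_algebra A" and "comm_banach_algebra B"
    and "banach_bimodule A B lact ract"
    and "symmetric_actions lact ract" and "compatible_actions A lact ract"
  shows "comm_banach_algebra (duplication A B lact ract)" (is "comm_banach_algebra ?D")
proof -
  interpret A: comm_banach_algebra A by fact
  interpret B: comm_banach_algebra B by fact
  interpret X: banach_bimodule A B lact ract by fact
  interpret D: complex_banach_space ?D
    by (rule complex_banach_space_duplication) unfold_locales
  have sm: "smul ?D c p = (smul A c (fst p), smul B c (snd p))" for c p
    by (simp add: duplication_def split: prod.split)
  have nm: "nrm ?D p = nrm A (fst p) + nrm B (snd p)" for p
    by (simp add: duplication_def split: prod.split)
  have ra: "ract a b = lact b a" for a b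
    using assms(4) by (simp add: symmetric_actions_def)
  have mu: "mul ?D p q = (mul A (fst p) (fst q) + lact (snd q) (fst p) + lact (snd p) (fst q),
      mul B (snd p) (snd q))" for p q
    by (simp add: duplication_def ra split: prod.split)
  note lin = A.mul_linear_right A.mul_linear_left B.mul_linear_right B.mul_linear_left
    X.lact_linear_right X.lact_linear_left
  note add = lin[THEN Vector_Spaces.linear_iff[THEN iffD1], THEN conjunct2, THEN conjunct2,
      THEN conjunct1, rule_format]
  note scl = lin[THEN Vector_Spaces.linear_iff[THEN iffD1], THEN conjunct2, THEN conjunct2,
      THEN conjunct2, rule_format]
  have comp: "lact b (mul A a a') = mul A (lact b a) a'"
    "mul A a (lact b a') = mul A (lact b a) a'" for a a' b
    using assms(5) by (auto simp: compatible_actions_def ra)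
  have lc: "lact b (lact c a) = lact c (lact b a)" for a b c
    using X.lact_ract[of b a c] by (simp add: ra)
  have comm: "mul ?D x y = mul ?D y x" for x y
    by (simp add: mu A.mul_commute[of "fst x"] B.mul_commute[of "snd x"] add_ac)
  have assoc: "mul ?D (mul ?D x y) z = mul ?D x (mul ?D y z)" for x y z
    by (simp add: mu add comp A.mul_assoc B.mul_assoc X.lact_mul lc add_ac)
  have lr: "Vector_Spaces.linear (smul ?D) (smul ?D) (\<lambda>y. mul ?D x y)" for x
    unfolding Vector_Spaces.linear_iff
    by (auto simp: D.vector_space_axioms mu sm add scl A.scale_right_distrib add_ac)
  have ll: "Vector_Spaces.linear (smul ?D) (smul ?D) (\<lambda>x. mul ?D x y)" for y
    using lr[of y] by (simp add: comm[of y])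
  have nmul: "nrm ?D (mul ?D x y) \<le> nrm ?D x * nrm ?D y" for x y
  proof -
    have "nrm A (mul A (fst x) (fst y) + lact (snd y) (fst x) + lact (snd x) (fst y))
      \<le> nrm A (mul A (fst x) (fst y)) + nrm A (lact (snd y) (fst x)) + nrm A (lact (snd x) (fst y))"
      by (meson A.nrm_triangle add_right_mono order_trans)
    also have "\<dots> \<le> nrm A (fst x) * nrm A (fst y) + nrm B (snd y) * nrm A (fst x)
        + nrm B (snd x) * nrm A (fst y)"
      by (intro add_mono A.nrm_mul X.nrm_lact)
    finally show ?thesis
      using B.nrm_mul[of "snd x" "snd y"] by (simp add: mu nm algebra_simps)
  qed
  show ?thesis
    by (intro comm_banach_algebra.intro complex_banach_algebra.intro
        complex_banach_algebra_axioms.intro comm_banach_algebra_axioms.intro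
        D.complex_banach_space_axioms comm assoc lr ll nmul)
qed

end

theory Submission
  imports Defs
begin

text \<open>
  Restricting a character of \<open>A \<times> B\<close> to the two factors gives a multiplicative functional
  \<open>\<phi>\<close> on \<open>A\<close> and a multiplicative functional \<open>\<psi>\<close> on \<open>B\<close>.
  If \<open>\<phi> = 0\<close>, then \<open>\<psi>\<close> is an arbitrary character of \<open>B\<close>.  If
  \<open>\<phi> \<noteq> 0\<close>, then \<open>\<psi>\<close> is determined by
  \<open>\<phi> (b \<cdot> a) = \<psi> b * \<phi> a\<close>, and compatibility of the actions shows that every
  \<open>\<phi>\<close> does admit such a \<open>\<psi>\<close> (\<open>extend_left\<close>, \<open>lift_right\<close>).
  So the spectrum of the duplication is the disjoint union of the spectra of \<open>A\<close> and \<open>B\<close>.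
  Semisimplicity and the passage of regularity to the two factors follow from this description.

  The hard part is that the duplication of regular algebras is regular.  A character with
  \<open>\<phi> \<noteq> 0\<close> is separated from a closed set by an element of \<open>A\<close>
  (\<open>separate_left\<close>).  For a character with \<open>\<phi> = 0\<close>, regularity of
  \<open>B\<close> yields an element \<open>b\<close> with the right behaviour on the spectrum of \<open>B\<close>,
  but \<open>b\<close> need not vanish at the characters that extend those of \<open>A\<close>.  Those among
  them that lie in the closed set and do not vanish at \<open>b\<close> satisfy \<open>\<epsilon> \<le> \<bar>\<phi> a\<bar>\<close> for one of finitely many
  \<open>a\<close>.  It suffices to find \<open>u\<close> in \<open>A\<close> whose Gelfand transform is \<open>1\<close>
  wherever \<open>\<epsilon> \<le> \<bar>\<phi> a\<bar>\<close> (\<open>regular_local_unit\<close>), and to replace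
  \<open>b\<close> by \<open>b - u b\<close> once for every such \<open>a\<close> (\<open>separate_right\<close>).

  The local unit is a Riesz idempotent.  Let \<open>I\<close> be the ideal of those elements of \<open>A\<close>
  whose transform vanishes on \<open>N = {\<phi>. \<epsilon> \<le> \<bar>\<phi> a\<bar>}\<close>.  By regularity,
  every character of the unitization that kills \<open>I\<close> restricts on \<open>A\<close> either to a member
  of \<open>N\<close> or to zero.  Hence,
  in the unitization modulo \<open>I\<close>, the spectrum of \<open>a\<close> avoids the annulus
  \<open>0 < \<bar>z\<bar> < \<epsilon>\<close>, and the spectral projection \<open>p\<close> that belongs to the isolated point
  \<open>0\<close> gives \<open>u = 1 - p\<close>.  The contour integral for \<open>p\<close> is the limit of its Riemann
  sums, which for the roots of unity of order \<open>2^k\<close> on the circle of radius \<open>r\<close> are equal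
  to \<open>(1 - (a/r)^(2^k))^(-1)\<close>.

  That an element outside all kernels of characters is invertible is Gelfand's theory of maximal
  ideals (\<open>gelfand_mazur\<close>, \<open>ex_character_vanishing\<close>).  The same averages replace
  Liouville's theorem there: at a point where the norm of a resolvent defined on the whole plane is
  maximal, the resolvent is almost equal to its averages over small circles, which is impossible if
  the norm is smaller somewhere on the circle.
\<close>

section \<open>Multiplication rules\<close>

context complex_banach_algebra
begin

lemma mul_add_right: "mul A x (y + z) = mul A x y + mul A x z"
  and mul_smul_right: "mul A x (smul A c y) = smul A c (mul A x y)"
  and mul_add_left: "mul A (x + y) z = mul A x z + mul A y z"
  and mul_smul_left: "mul A (smul A c x) z = smul A c (mul A x z)"
  using mul_linear_right[of x] mul_linear_left[of z] by (simp_all add: Vector_Spaces.linear_iff)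

lemma mul_0_right [simp]: "mul A x 0 = 0"
  using mul_add_right[of x 0 0] by simp

lemma mul_0_left [simp]: "mul A 0 x = 0"
  using mul_add_left[of 0 0 x] by simp

lemma mul_diff_right: "mul A x (y - z) = mul A x y - mul A x z"
  using mul_add_right[of x "y - z" z] by (simp add: algebra_simps)

lemma mul_diff_left: "mul A (x - y) z = mul A x z - mul A y z"
  using mul_add_left[of "x - y" y z] by (simp add: algebra_simps)

lemmas bilinear_simps = mul_add_right mul_add_left mul_diff_right mul_diff_left
  mul_smul_right mul_smul_left scale_right_distrib scale_left_distrib
  scale_right_diff_distrib scale_left_diff_distrib mul_assoc

end

context comm_banach_algebra
begin

lemma mul_left_commute: "mul A x (mul A y z) = mul A y (mul A x z)"
  by (metis mul_assoc mul_commute)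

lemmas mul_simps = bilinear_simps mul_commute mul_left_commute

end

section \<open>Characters\<close>

lemma spectrum_iff:
  assumes "vector_space (smul C)"
  shows "\<phi> \<in> spectrum C \<longleftrightarrow> (\<forall>x y. \<phi> (x + y) = \<phi> x + \<phi> y) \<and> (\<forall>c x. \<phi> (smul C c x) = c * \<phi> x) \<and>
    (\<forall>x y. \<phi> (mul C x y) = \<phi> x * \<phi> y) \<and> (\<exists>x. \<phi> x \<noteq> 0)"
proof -
  have "vector_space ((*) :: complex \<Rightarrow> complex \<Rightarrow> complex)"
    by unfold_locales (simp_all add: algebra_simps)
  with assms show ?thesis
    unfolding spectrum_def Vector_Spaces.linear_iff by auto
qed

context complex_banach_algebra
begin

lemma spectrumI:
  assumes "\<And>x y. \<phi> (x + y) = \<phi> x + \<phi> y" "\<And>c x. \<phi> (smul A c x) = c * \<phi> x"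
    "\<And>x y. \<phi> (mul A x y) = \<phi> x * \<phi> y" "\<phi> x \<noteq> 0"
  shows "\<phi> \<in> spectrum A"
  using assms by (auto simp: spectrum_iff[OF vector_space_axioms])

lemma character_simps:
  assumes "\<phi> \<in> spectrum A"
  shows "\<phi> (x + y) = \<phi> x + \<phi> y" "\<phi> (smul A c x) = c * \<phi> x" "\<phi> (mul A x y) = \<phi> x * \<phi> y"
    "\<phi> 0 = 0" "\<phi> (x - y) = \<phi> x - \<phi> y"
proof -
  show add: "\<phi> (x + y) = \<phi> x + \<phi> y" and "\<phi> (smul A c x) = c * \<phi> x" "\<phi> (mul A x y) = \<phi> x * \<phi> y" for x y
    using assms by (auto simp: spectrum_iff[OF vector_space_axioms])
  show "\<phi> 0 = 0" using add[of 0 0] by simp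
  show "\<phi> (x - y) = \<phi> x - \<phi> y" using add[of "x - y" y] by simp
qed

lemma character_nonzero:
  assumes "\<phi> \<in> spectrum A"
  obtains x where "\<phi> x = 1"
proof -
  obtain y where "\<phi> y \<noteq> 0"
    using assms by (auto simp: spectrum_iff[OF vector_space_axioms])
  then have "\<phi> (smul A (1 / \<phi> y) y) = 1"
    by (simp add: character_simps[OF assms])
  then show ?thesis by (rule that)
qed

lemma semisimple_iff: "semisimple A \<longleftrightarrow> (\<forall>x. (\<forall>\<phi>\<in>spectrum A. \<phi> x = 0) \<longrightarrow> x = 0)"
proof -
  have eq: "gelfand A x = gelfand A y \<longleftrightarrow> (\<forall>\<phi>\<in>spectrum A. \<phi> (x - y) = 0)" for x y
    by (auto simp: gelfand_def fun_eq_iff restrict_def character_simps split: if_splits)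
  show ?thesis unfolding semisimple_def inj_def eq
    by (metis diff_0_right eq_iff_diff_eq_0)
qed

end

text \<open>
  A base of neighbourhoods of \<open>\<phi>0\<close> is given by the conditions
  \<open>\<bar>\<phi> x - \<phi>0 x\<bar> < e\<close> for \<open>x\<close> in a finite set.  It is enough to
  separate \<open>\<phi>0\<close> from the complements of these, which removes the topology from all arguments
  below.
\<close>

lemma regular_iff:
  fixes C :: "'a::ab_group_add alg"
  shows "regular C \<longleftrightarrow> (\<forall>\<phi>0\<in>spectrum C. \<forall>X e. finite X \<and> (0::real) < e \<longrightarrow>
     (\<exists>c. \<phi>0 c \<noteq> 0 \<and> (\<forall>\<phi>\<in>spectrum C. (\<exists>x\<in>X. e \<le> cmod (\<phi> x - \<phi>0 x)) \<longrightarrow> \<phi> c = 0)))"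
  (is "?L \<longleftrightarrow> ?R")
proof
  assume L: ?L
  show ?R
  proof (intro ballI allI impI, elim conjE)
    fix \<phi>0 and X :: "'a set" and e :: real
    assume \<phi>0: "\<phi>0 \<in> spectrum C" and X: "finite X" and e: "0 < e"
    define U where "U = {\<phi>::'a \<Rightarrow> complex. \<forall>x\<in>X. \<phi> (id x) \<in> ball (\<phi>0 x) e}"
    have "open U" unfolding U_def by (intro product_topology_basis' X) simp
    then have "closedin (gelfand_topology C) (spectrum C \<inter> - U)"
      unfolding gelfand_topology_def by (metis closedin_closed_Int closed_Compl)
    moreover have "\<phi>0 \<in> spectrum C - (spectrum C \<inter> - U)"
      using \<phi>0 e by (simp add: U_def)
    ultimately obtain c where "\<phi>0 c \<noteq> 0" "\<forall>\<phi>\<in>spectrum C \<inter> - U. \<phi> c = 0"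
      using L unfolding regular_def by blast
    then show "\<exists>c. \<phi>0 c \<noteq> 0 \<and> (\<forall>\<phi>\<in>spectrum C. (\<exists>x\<in>X. e \<le> cmod (\<phi> x - \<phi>0 x)) \<longrightarrow> \<phi> c = 0)"
      by (intro exI[of _ c]) (force simp: U_def dist_norm norm_minus_commute not_less)
  qed
next
  assume R: ?R
  show ?L unfolding regular_def
  proof (intro allI impI, elim conjE)
    fix E \<phi>0
    assume "closedin (gelfand_topology C) E" and \<phi>0: "\<phi>0 \<in> spectrum C - E"
    then obtain F where F: "closed F" "E = spectrum C \<inter> F"
      unfolding gelfand_topology_def closedin_closed by auto
    have "openin (product_topology (\<lambda>_. euclidean) UNIV) (- F)" "\<phi>0 \<in> - F"
      using F \<phi>0 by (auto simp: open_fun_def[symmetric])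
    from product_topology_open_contains_basis[OF this]
    obtain V where V: "\<phi>0 \<in> Pi\<^sub>E UNIV V" "\<And>x. open (V x)" "finite {x. V x \<noteq> UNIV}"
      "Pi\<^sub>E UNIV V \<subseteq> - F" by auto
    define X where "X = {x. V x \<noteq> UNIV}"
    have "\<forall>x. \<exists>d>0. ball (\<phi>0 x) d \<subseteq> V x"
      using V(1,2) by (meson PiE_E UNIV_I open_contains_ball)
    then obtain d where d: "\<And>x. d x > 0" "\<And>x. ball (\<phi>0 x) (d x) \<subseteq> V x" by metis
    define e where "e = Min (insert 1 (d ` X))"
    have X: "finite X" using V(3) by (simp add: X_def)
    then have e: "e > 0" "\<And>x. x \<in> X \<Longrightarrow> e \<le> d x"
      using d(1) by (auto simp: e_def)
    have far: "\<exists>x\<in>X. e \<le> cmod (\<phi> x - \<phi>0 x)" if "\<phi> \<in> E" for \<phi>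
    proof (rule ccontr)
      assume "\<not> ?thesis"
      then have "\<phi> x \<in> V x" if "x \<in> X" for x
        using d(2)[of x] e(2)[OF that] that
        by (force simp: dist_norm norm_minus_commute not_le)
      then have "\<phi> x \<in> V x" for x
        by (cases "x \<in> X") (auto simp: X_def)
      then have "\<phi> \<in> Pi\<^sub>E UNIV V" by auto
      with V(4) F that show False by auto
    qed
    obtain c where "\<phi>0 c \<noteq> 0"
      "\<forall>\<phi>\<in>spectrum C. (\<exists>x\<in>X. e \<le> cmod (\<phi> x - \<phi>0 x)) \<longrightarrow> \<phi> c = 0"
      using R \<phi>0 X e by blast
    then show "\<exists>c. \<phi>0 c \<noteq> 0 \<and> (\<forall>\<phi>\<in>E. \<phi> c = 0)" using far F by blast
  qed
qed

lemma regularD: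
  assumes "regular C" "\<phi>0 \<in> spectrum C" "finite X" "(0::real) < e"
  shows "\<exists>c. \<phi>0 c \<noteq> 0 \<and> (\<forall>\<phi>\<in>spectrum C. (\<exists>x\<in>X. e \<le> cmod (\<phi> x - \<phi>0 x)) \<longrightarrow> \<phi> c = 0)"
  using assms unfolding regular_iff by blast

section \<open>Unital algebras\<close>

locale unital_comm_banach_algebra = comm_banach_algebra A
  for A :: "'a::ab_group_add alg" +
  fixes e :: 'a
  assumes mul_unit: "mul A e x = x" and nrm_unit: "nrm A e = 1"
begin

lemma mul_unit_right: "mul A x e = x"
  by (metis mul_unit mul_commute)

text \<open>
  The inverse of \<open>e - x\<close> is the fixed point of the contraction \<open>s \<mapsto> e + x s\<close>.
\<close>

lemma neumann_inverse:
  assumes "nrm A x < 1"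
  shows "\<exists>s. mul A s (e - x) = e"
proof -
  interpret M: Metric_space UNIV "\<lambda>x y. nrm A (x - y)" by (rule nrm_metric)
  have "nrm A (e + mul A x y - (e + mul A x z)) \<le> nrm A x * nrm A (y - z)" for y z
    using nrm_mul[of x "y - z"] by (simp add: mul_diff_right)
  with assms complete obtain s where "e + mul A x s = s"
    by (auto intro: M.Banach_fixedpoint_thm[of "\<lambda>s. e + mul A x s" "nrm A x"])
  then have "mul A s (e - x) = e"
    by (simp add: mul_diff_right mul_unit_right mul_commute[of s]) (metis add_diff_cancel_right')
  then show ?thesis ..
qed

lemma character_unit:
  assumes "\<phi> \<in> spectrum A"
  shows "\<phi> e = 1"
proof -
  obtain x where "\<phi> x = 1" using character_nonzero[OF assms] .
  then show ?thesis
    using character_simps(3)[OF assms, of e x] by (simp add: mul_unit)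
qed

text \<open>
  If \<open>\<bar>\<phi> x\<bar>\<close> exceeded the norm of \<open>x\<close>, then \<open>e - x / \<phi> x\<close>
  would be an invertible element of the kernel.
\<close>

lemma character_bounded:
  assumes "\<phi> \<in> spectrum A"
  shows "cmod (\<phi> x) \<le> nrm A x"
proof (rule ccontr)
  note ch = character_simps[OF assms]
  assume "\<not> ?thesis"
  then have *: "nrm A x < cmod (\<phi> x)" by simp
  then have 0: "\<phi> x \<noteq> 0" using nrm_nonneg[of x] by auto
  have "nrm A (smul A (1 / \<phi> x) x) < 1"
    using * 0 by (simp add: nrm_smul norm_divide divide_simps)
  then obtain s where "mul A s (e - smul A (1 / \<phi> x) x) = e"
    using neumann_inverse by blast
  then have "\<phi> s * (\<phi> e - 1) = \<phi> e" using 0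
    by (metis ch(2,3,5) nonzero_divide_eq_eq)
  then show False by (simp add: character_unit[OF assms])
qed

end

section \<open>Calculus modulo an ideal\<close>

text \<open>
  The quotient algebra is not formed.  Equations in it are written as membership of a difference in
  \<open>I\<close>, and its norm is the seminorm \<open>qnrm\<close>.
\<close>

locale proper_ideal = unital_comm_banach_algebra A e
  for A :: "'a::ab_group_add alg" and e +
  fixes I :: "'a set"
  assumes zero_mem: "0 \<in> I"
    and add_mem: "x \<in> I \<Longrightarrow> y \<in> I \<Longrightarrow> x + y \<in> I"
    and mul_mem: "y \<in> I \<Longrightarrow> mul A x y \<in> I"
    and unit_notin: "e \<notin> I"
begin

lemma smul_mem: "x \<in> I \<Longrightarrow> smul A c x \<in> I"
  using mul_mem[of x "smul A c e"] by (simp add: mul_smul_left mul_unit)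

lemma uminus_mem: "x \<in> I \<Longrightarrow> - x \<in> I"
  using smul_mem[of x "-1"] by simp

lemma diff_mem: "x \<in> I \<Longrightarrow> y \<in> I \<Longrightarrow> x - y \<in> I"
  using add_mem[of x "- y"] uminus_mem by simp

subsection \<open>The quotient seminorm\<close>

definition qnrm :: "'a \<Rightarrow> real"
  where "qnrm x = (INF i\<in>I. nrm A (x - i))"

lemma qnrm_le: "i \<in> I \<Longrightarrow> qnrm x \<le> nrm A (x - i)"
  unfolding qnrm_def by (intro cINF_lower bdd_belowI2[of _ 0] nrm_nonneg)

lemma le_qnrm: "(\<And>i. i \<in> I \<Longrightarrow> c \<le> nrm A (x - i)) \<Longrightarrow> c \<le> qnrm x"
  unfolding qnrm_def using zero_mem by (intro cINF_greatest) auto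

lemma qnrm_nonneg: "0 \<le> qnrm x"
  by (intro le_qnrm nrm_nonneg)

lemma qnrm_approx:
  assumes "0 < d"
  shows "\<exists>i\<in>I. nrm A (x - i) < qnrm x + d"
  using le_qnrm[of "qnrm x + d" x] assms by force

lemma le_scaled_qnrm:
  assumes "\<And>i. i \<in> I \<Longrightarrow> c \<le> k * nrm A (x - i)" "0 \<le> k"
  shows "c \<le> k * qnrm x"
proof (cases "k = 0")
  case True
  then show ?thesis using assms(1)[OF zero_mem] by simp
next
  case False
  then have "c / k \<le> qnrm x"
    using assms by (intro le_qnrm) (simp add: divide_simps mult.commute)
  then show ?thesis using False assms(2) by (simp add: divide_simps mult.commute)
qed

lemma qnrm_cong:
  assumes "x - y \<in> I"
  shows "qnrm x = qnrm y"
proof -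
  have "qnrm x \<le> qnrm y" if "x - y \<in> I" for x y
  proof (rule le_qnrm)
    fix i assume "i \<in> I"
    from qnrm_le[OF add_mem[OF that this], of x]
    show "qnrm x \<le> nrm A (y - i)" by (simp add: algebra_simps)
  qed
  from this[OF assms] this[of y x] uminus_mem[OF assms] show ?thesis by simp
qed

lemma qnrm_triangle: "qnrm (x + y) \<le> qnrm x + qnrm y"
proof -
  have "qnrm (x + y) - nrm A (x - i) \<le> nrm A (y - j)" if "i \<in> I" "j \<in> I" for i j
    using qnrm_le[OF add_mem[OF that], of "x + y"] nrm_triangle[of "x - i" "y - j"]
    by (simp add: algebra_simps)
  then have "qnrm (x + y) - nrm A (x - i) \<le> qnrm y" if "i \<in> I" for i
    using that by (intro le_qnrm)
  then have "qnrm (x + y) - qnrm y \<le> qnrm x"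
    by (intro le_qnrm) (simp add: algebra_simps)
  then show ?thesis by simp
qed

lemma qnrm_smul: "qnrm (smul A c x) \<le> cmod c * qnrm x"
proof (rule le_scaled_qnrm)
  fix i assume "i \<in> I"
  from qnrm_le[OF smul_mem[OF this], of "smul A c x" c]
  show "qnrm (smul A c x) \<le> cmod c * nrm A (x - i)"
    by (simp add: nrm_smul flip: scale_right_diff_distrib)
qed simp

lemma qnrm_uminus: "qnrm (- x) = qnrm x"
  using qnrm_smul[of "-1" x] qnrm_smul[of "-1" "- x"] by simp

lemma qnrm_diff: "qnrm (x - y) \<le> qnrm x + qnrm y"
  using qnrm_triangle[of x "- y"] by (simp add: qnrm_uminus)

lemma qnrm_mul: "qnrm (mul A x y) \<le> qnrm x * qnrm y"
proof (rule le_scaled_qnrm[OF _ qnrm_nonneg])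
  fix j assume j: "j \<in> I"
  have "qnrm (mul A x y) \<le> nrm A (y - j) * nrm A (x - i)" if i: "i \<in> I" for i
  proof -
    have "mul A x j + mul A (y - j) i \<in> I"
      using i j by (intro add_mem mul_mem)
    from qnrm_le[OF this, of "mul A x y"]
    have "qnrm (mul A x y) \<le> nrm A (mul A (x - i) (y - j))"
      by (simp add: mul_simps algebra_simps)
    also have "\<dots> \<le> nrm A (x - i) * nrm A (y - j)" by (rule nrm_mul)
    finally show ?thesis by (simp add: mult.commute)
  qed
  then have "qnrm (mul A x y) \<le> nrm A (y - j) * qnrm x"
    by (intro le_scaled_qnrm nrm_nonneg)
  then show "qnrm (mul A x y) \<le> qnrm x * nrm A (y - j)" by (simp add: mult.commute)
qed

text \<open>
  An element of the ideal at distance less than \<open>1\<close> from the unit would be invertible.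
\<close>

lemma qnrm_unit: "qnrm e = 1"
proof (rule antisym)
  show "qnrm e \<le> 1" using qnrm_le[OF zero_mem, of e] by (simp add: nrm_unit)
  show "1 \<le> qnrm e"
  proof (rule le_qnrm, rule ccontr)
    fix i assume i: "i \<in> I" and "\<not> 1 \<le> nrm A (e - i)"
    then obtain s where "mul A s i = e" using neumann_inverse[of "e - i"] by auto
    then show False using mul_mem[OF i, of s] unit_notin by simp
  qed
qed

subsection \<open>Resolvents\<close>

text \<open>
  This is the resolvent identity: modulo \<open>I\<close>, the difference of the inverses \<open>x\<close> of
  \<open>u - z v\<close> and \<open>y\<close> of \<open>u - w v\<close> is \<open>(z - w) x y v\<close>.
\<close>

lemma resolvent_diff:
  assumes "mul A x (u - smul A z v) - e \<in> I" "mul A y (u - smul A w v) - e \<in> I"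
  shows "qnrm (x - y) \<le> cmod (z - w) * qnrm v * (qnrm x * qnrm y)"
proof -
  have "x - y - smul A (z - w) (mul A (mul A x y) v) =
      mul A y (mul A x (u - smul A z v) - e) - mul A x (mul A y (u - smul A w v) - e)"
    by (simp add: mul_simps mul_unit mul_unit_right algebra_simps)
  also have "\<dots> \<in> I" by (intro diff_mem mul_mem assms)
  finally have "qnrm (x - y) = qnrm (smul A (z - w) (mul A (mul A x y) v))"
    by (rule qnrm_cong)
  also have "\<dots> \<le> cmod (z - w) * qnrm (mul A (mul A x y) v)" by (rule qnrm_smul)
  also have "\<dots> \<le> cmod (z - w) * ((qnrm x * qnrm y) * qnrm v)"
    by (intro mult_left_mono order_trans[OF qnrm_mul] mult_right_mono qnrm_mul qnrm_nonneg) simp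
  finally show ?thesis by (simp add: mult_ac)
qed

lemma qnrm_inverse_pos:
  assumes "mul A x y - e \<in> I"
  shows "0 < qnrm x"
proof (rule ccontr)
  assume "\<not> 0 < qnrm x"
  then have "qnrm x = 0" using qnrm_nonneg[of x] by simp
  then have "qnrm (mul A x y) \<le> 0" using qnrm_mul[of x y] by simp
  then show False using qnrm_cong[OF assms] qnrm_unit by simp
qed

text \<open>
  The resolvent identity makes the reciprocal of \<open>qnrm (f z)\<close> a Lipschitz function of \<open>z\<close>
  before any bound on \<open>f\<close> itself is known.
\<close>

lemma continuous_qnrm_resolvent:
  assumes f: "\<And>z. z \<in> K \<Longrightarrow> mul A (f z) (u - smul A z v) - e \<in> I"
  shows "continuous_on K (\<lambda>z. qnrm (f z))"
proof -
  have pos: "0 < qnrm (f z)" if "z \<in> K" for z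
    using qnrm_inverse_pos f that by blast
  have "(qnrm v)-lipschitz_on K (\<lambda>z. 1 / qnrm (f z))"
  proof (rule lipschitz_onI)
    fix z w assume zw: "z \<in> K" "w \<in> K"
    have *: "qnrm (f a) - qnrm (f b) \<le> dist z w * qnrm v * (qnrm (f z) * qnrm (f w))"
      if "a = z \<and> b = w \<or> a = w \<and> b = z" for a b
    proof -
      have "qnrm (f a) \<le> qnrm (f b) + qnrm (f a - f b)"
        using qnrm_triangle[of "f b" "f a - f b"] by simp
      with resolvent_diff[OF f f, of a b] that zw show ?thesis
        by (auto simp: dist_norm norm_minus_commute mult_ac)
    qed
    from *[of z w] *[of w z]
    have "\<bar>qnrm (f w) - qnrm (f z)\<bar> \<le> dist z w * qnrm v * (qnrm (f z) * qnrm (f w))"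
      by simp
    then have "\<bar>qnrm (f w) - qnrm (f z)\<bar> / (qnrm (f z) * qnrm (f w)) \<le> dist z w * qnrm v"
      using pos zw by (simp add: pos_divide_le_eq)
    also have "\<bar>qnrm (f w) - qnrm (f z)\<bar> / (qnrm (f z) * qnrm (f w))
        = dist (1 / qnrm (f z)) (1 / qnrm (f w))"
      using pos[OF zw(1)] pos[OF zw(2)]
      by (simp add: dist_real_def diff_frac_eq abs_mult abs_div)
    finally show "dist (1 / qnrm (f z)) (1 / qnrm (f w)) \<le> qnrm v * dist z w"
      by (simp add: mult.commute)
  qed (rule qnrm_nonneg)
  then have "continuous_on K (\<lambda>z. 1 / (1 / qnrm (f z)))"
    using pos by (intro continuous_intros lipschitz_on_continuous_on) force+
  then show ?thesis by simp
qed

subsection \<open>Averages over roots of unity\<close>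

text \<open>
  This is the mean of \<open>f (z \<zeta>)\<close> over the roots of unity \<open>\<zeta>\<close> of order \<open>2^k\<close>:
  those of order \<open>2^(k+1)\<close> are the ones of order \<open>2^k\<close> and their multiples by
  \<open>cis (pi / 2^k)\<close>.  Doubling the order makes each property of the averages a one-step
  induction.
\<close>

primrec root_avg :: "nat \<Rightarrow> (complex \<Rightarrow> 'a) \<Rightarrow> complex \<Rightarrow> 'a" where
  "root_avg 0 f z = f z"
| "root_avg (Suc k) f z = smul A (1/2) (root_avg k f z + root_avg k f (z * cis (pi / 2 ^ k)))"

primrec repeated_square :: "nat \<Rightarrow> 'a \<Rightarrow> 'a" where
  "repeated_square 0 x = x"
| "repeated_square (Suc k) x = mul A (repeated_square k x) (repeated_square k x)"

lemma qnrm_half: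
  assumes "qnrm x \<le> a" "qnrm y \<le> b"
  shows "qnrm (smul A (1/2) (x + y)) \<le> (a + b) / 2"
  using qnrm_smul[of "1/2" "x + y"] qnrm_triangle[of x y] assms by (simp add: norm_divide)

lemma qnrm_repeated_square: "qnrm (repeated_square k x) \<le> qnrm x ^ 2 ^ k"
proof (induction k)
  case (Suc k)
  have "qnrm (repeated_square (Suc k) x) \<le> qnrm (repeated_square k x) * qnrm (repeated_square k x)" by (simp add: qnrm_mul)
  also have "\<dots> \<le> qnrm x ^ 2 ^ k * qnrm x ^ 2 ^ k"
    using Suc by (intro mult_mono qnrm_nonneg zero_le_power)
  finally show ?case by (simp add: mult_2 power_add)
qed simp

lemma cis_pi_power: "cis (pi / 2 ^ k) ^ 2 ^ k = -1"
  using Complex.DeMoivre[of "pi / 2 ^ k" "2 ^ k"] by simp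

text \<open>
  Averaging resolvents raises the argument to a power:
  \<open>1/2 (y / (1 - t) + y / (1 + t)) = y / (1 - t^2)\<close>.  Here \<open>y\<close> is \<open>e\<close> when the
  spectral projection is constructed, and a resolvent in the maximum argument of the next section.
\<close>

lemma root_avg_resolvent:
  assumes f: "\<And>z. cmod z = 1 \<Longrightarrow> mul A (f z) (e - smul A z s) - y \<in> I" and z: "cmod z = 1"
  shows "mul A (root_avg k f z) (e - smul A (z ^ 2 ^ k) (repeated_square k s)) - y \<in> I"
  using z
proof (induction k arbitrary: z)
  case 0
  then show ?case using f by simp
next
  case (Suc k)
  define G G' t where "G = root_avg k f z" and "G' = root_avg k f (z * cis (pi / 2 ^ k))"
    and "t = smul A (z ^ 2 ^ k) (repeated_square k s)"
  have G: "mul A G (e - t) - y \<in> I"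
    using Suc.IH[of z] Suc.prems by (simp add: G_def t_def)
  have G': "mul A G' (e + t) - y \<in> I"
    using Suc.IH[of "z * cis (pi / 2 ^ k)"] Suc.prems
    by (simp add: G'_def t_def norm_mult power_mult_distrib cis_pi_power)
  have sq: "smul A (z ^ 2 ^ Suc k) (repeated_square (Suc k) s) = mul A t t"
    by (simp add: t_def mul_smul_left mul_smul_right mult_2 power_add)
  have half: "smul A (1/2) y + smul A (1/2) y = y"
    by (simp flip: scale_left_distrib)
  have "mul A (root_avg (Suc k) f z) (e - mul A t t) - y
      = mul A (smul A (1/2) (G + G')) (e - mul A t t) - (smul A (1/2) y + smul A (1/2) y)"
    by (simp add: G_def G'_def half)
  also have "\<dots> = smul A (1/2) (mul A (e + t) (mul A G (e - t) - y)
      + mul A (e - t) (mul A G' (e + t) - y))"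
    by (simp add: mul_simps mul_unit mul_unit_right algebra_simps)
  also have "\<dots> \<in> I" by (intro smul_mem add_mem mul_mem G G')
  finally show ?case by (simp only: sq)
qed

lemma qnrm_root_avg_le:
  assumes "\<And>z. cmod z = 1 \<Longrightarrow> qnrm (f z) \<le> m" "cmod z = 1"
  shows "qnrm (root_avg k f z) \<le> m"
  using assms(2)
proof (induction k arbitrary: z)
  case (Suc k)
  show ?case
    using qnrm_half[OF Suc.IH Suc.IH, of z "z * cis (pi / 2 ^ k)"] Suc.prems
    by (simp add: norm_mult)
qed (simp add: assms)

text \<open>
  One of the \<open>2^k\<close> terms of the average is \<open>f 1\<close>, so a gain of \<open>d\<close> there
  contributes \<open>d / 2^k\<close>.
\<close>

lemma qnrm_root_avg_less:
  assumes f: "\<And>z. cmod z = 1 \<Longrightarrow> qnrm (f z) \<le> m" and "qnrm (f 1) \<le> m - d"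
  shows "qnrm (root_avg k f 1) \<le> m - d / 2 ^ k"
proof (induction k)
  case (Suc k)
  have "qnrm (root_avg k f (1 * cis (pi / 2 ^ k))) \<le> m"
    by (intro qnrm_root_avg_le f) simp_all
  from qnrm_half[OF Suc this] show ?case by (simp add: field_simps)
qed (simp add: assms)

lemma qnrm_root_avg_lipschitz:
  assumes f: "\<And>z w. cmod z = 1 \<Longrightarrow> cmod w = 1 \<Longrightarrow> qnrm (f z - f w) \<le> L * cmod (z - w)"
    and "cmod z = 1" "cmod w = 1"
  shows "qnrm (root_avg k f z - root_avg k f w) \<le> L * cmod (z - w)"
  using assms(2,3)
proof (induction k arbitrary: z w)
  case (Suc k)
  define \<zeta> where "\<zeta> = cis (pi / 2 ^ k)"
  have "cmod (z * \<zeta> - w * \<zeta>) = cmod (z - w)"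
    unfolding \<zeta>_def by (simp add: norm_mult flip: left_diff_distrib)
  then have "qnrm (root_avg k f (z * \<zeta>) - root_avg k f (w * \<zeta>)) \<le> L * cmod (z - w)"
    using Suc.IH[of "z * \<zeta>" "w * \<zeta>"] Suc.prems by (simp add: norm_mult \<zeta>_def)
  from qnrm_half[OF Suc.IH[OF Suc.prems] this] show ?case
    by (simp add: \<zeta>_def algebra_simps)
qed (simp add: f)

text \<open>
  The averages of a Lipschitz function inherit its constant, and consecutive ones differ by a rotation
  through the angle \<open>pi / 2^k\<close>.  So they converge geometrically.
\<close>

lemma qnrm_root_avg_step:
  assumes f: "\<And>z w. cmod z = 1 \<Longrightarrow> cmod w = 1 \<Longrightarrow> qnrm (f z - f w) \<le> L * cmod (z - w)"
    and "0 \<le> L"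
  shows "qnrm (root_avg (Suc k) f 1 - root_avg k f 1) \<le> 2 * L * (1/2) ^ k"
proof -
  define \<zeta> where "\<zeta> = cis (pi / 2 ^ k)"
  have half: "smul A (1/2) x + smul A (1/2) x = x" for x
    by (simp flip: scale_left_distrib)
  have "root_avg (Suc k) f 1 - root_avg k f 1
      = root_avg (Suc k) f 1 - (smul A (1/2) (root_avg k f 1) + smul A (1/2) (root_avg k f 1))"
    by (simp only: half)
  also have "\<dots> = smul A (1/2) (root_avg k f \<zeta> - root_avg k f 1)"
    by (simp add: \<zeta>_def scale_right_distrib scale_right_diff_distrib)
  finally have eq: "root_avg (Suc k) f 1 - root_avg k f 1 = smul A (1/2) (root_avg k f \<zeta> - root_avg k f 1)" .
  have "qnrm (root_avg (Suc k) f 1 - root_avg k f 1) \<le> 1/2 * qnrm (root_avg k f \<zeta> - root_avg k f 1)"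
    unfolding eq using qnrm_smul[of "1/2" "root_avg k f \<zeta> - root_avg k f 1"] by (simp add: norm_divide)
  also have "\<dots> \<le> 1/2 * (L * cmod (\<zeta> - 1))"
  proof -
    have "qnrm (root_avg k f \<zeta> - root_avg k f 1) \<le> L * cmod (\<zeta> - 1)"
      by (rule qnrm_root_avg_lipschitz) (auto simp: f \<zeta>_def)
    then show ?thesis by simp
  qed
  also have "\<dots> \<le> 1/2 * (L * (pi / 2 ^ k))"
  proof -
    have "cmod (\<zeta> - 1) = 2 * \<bar>sin (pi / 2 ^ k / 2)\<bar>"
      unfolding \<zeta>_def cis_conv_exp by (rule dist_exp_i_1)
    also have "\<dots> \<le> 2 * \<bar>pi / 2 ^ k / 2\<bar>"
      by (intro mult_left_mono abs_sin_x_le_abs_x) simp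
    finally have "cmod (\<zeta> - 1) \<le> pi / 2 ^ k" by simp
    then show ?thesis using \<open>0 \<le> L\<close> by (intro mult_left_mono) auto
  qed
  also have "\<dots> \<le> 1/2 * (L * (4 / 2 ^ k))"
    using \<open>0 \<le> L\<close> pi_less_4 by (intro mult_left_mono divide_right_mono) auto
  also have "\<dots> = 2 * L * (1/2) ^ k" by (simp add: power_one_over)
  finally show ?thesis .
qed

end

section \<open>Existence of characters\<close>

context proper_ideal
begin

text \<open>
  Suppose that the resolvent \<open>f\<close> of \<open>x\<close> exists on the whole plane.  Its norm \<open>g\<close> tends
  to \<open>0\<close> at infinity, hence has a maximum \<open>m\<close>, attained on a compact set.  Let \<open>z0\<close> be
  the point of this set with the largest real part; then \<open>g\<close> is less than \<open>m\<close> by some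
  \<open>d > 0\<close> at \<open>z0 + \<rho>\<close>.  The average of \<open>f\<close> over \<open>2^k\<close> points of the circle
  of radius \<open>\<rho>\<close> about \<open>z0\<close> has norm at most \<open>m - d / 2^k\<close>, but its distance to \<open>f z0\<close> is at most of the order of \<open>(1/2)^(2^k)\<close>, which is much less.
\<close>

theorem gelfand_mazur: "\<exists>z. \<forall>y. mul A y (x - smul A z e) - e \<notin> I"
proof (rule ccontr)
  assume "\<not> ?thesis"
  then obtain f where f: "\<And>z. mul A (f z) (x - smul A z e) - e \<in> I" by metis
  define g where "g z = qnrm (f z)" for z
  have pos: "0 < g z" for z unfolding g_def by (rule qnrm_inverse_pos[OF f])
  have cont: "continuous_on UNIV g" unfolding g_def
    by (rule continuous_qnrm_resolvent[of UNIV f x e]) (rule f)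
  have decay: "(cmod z - qnrm x) * g z \<le> 1" for z
  proof (cases "z = 0")
    case True
    have "0 \<le> qnrm x * g 0" using qnrm_nonneg[of x] pos[of 0] by simp
    then have "- 1 \<le> qnrm x * g 0" by linarith
    then show ?thesis using True by simp
  next
    case False
    have "f z - smul A (1 / z) (mul A x (f z) - e) = smul A (- 1 / z) (mul A (f z) (x - smul A z e) - e)"
      using False by (simp add: mul_simps mul_unit mul_unit_right algebra_simps)
    also have "\<dots> \<in> I" by (rule smul_mem[OF f])
    finally have "g z = qnrm (smul A (1 / z) (mul A x (f z) - e))"
      unfolding g_def by (rule qnrm_cong)
    also have "\<dots> \<le> cmod (1 / z) * (qnrm x * g z + 1)"
      unfolding g_def by (intro order_trans[OF qnrm_smul] mult_left_mono order_trans[OF qnrm_diff]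
        add_mono qnrm_mul) (simp_all add: qnrm_unit)
    finally show ?thesis using False by (simp add: norm_divide field_simps)
  qed
  define R where "R = qnrm x + 1 / g 0"
  have R: "g z < g 0" if "R < cmod z" for z
  proof -
    have "1 / g 0 < cmod z - qnrm x" using that by (simp add: R_def)
    then have "1 / g 0 * g z < (cmod z - qnrm x) * g z"
      by (intro mult_strict_right_mono pos)
    also have "\<dots> \<le> 1" by (rule decay)
    finally show ?thesis using pos[of 0] by (simp add: field_simps)
  qed
  have "0 \<le> R" using qnrm_nonneg[of x] pos[of 0] by (simp add: R_def)
  then obtain z1 where z1: "z1 \<in> cball 0 R" "\<And>z. z \<in> cball 0 R \<Longrightarrow> g z \<le> g z1"
    using continuous_attains_sup[of "cball 0 R" g] continuous_on_subset[OF cont] by auto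
  define m where "m = g z1"
  have max: "g z \<le> m" for z
    using z1(2)[of z] z1(2)[of 0] R[of z] \<open>0 \<le> R\<close>
    by (cases "cmod z \<le> R") (auto simp: m_def)
  have "{z. g z = m} \<subseteq> cball 0 R"
    using R max[of 0] by (force simp: not_less[symmetric])
  moreover have "closed {z. g z = m}"
    by (intro closed_Collect_eq cont continuous_intros)
  ultimately have "compact {z. g z = m}"
    using bounded_cball bounded_subset by (auto simp: compact_eq_bounded_closed)
  moreover have "z1 \<in> {z. g z = m}" by (simp add: m_def)
  moreover have "continuous_on {z. g z = m} Re" by (intro continuous_intros)
  ultimately obtain z0 where z0: "g z0 = m" "\<And>z. g z = m \<Longrightarrow> Re z \<le> Re z0"
    using continuous_attains_sup[of "{z. g z = m}" Re] by blast
  have m: "0 < m" using pos by (simp add: m_def)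
  \<comment> \<open>Half the radius of convergence of the power series of \<open>f\<close> at \<open>z0\<close> that the bound \<open>m\<close> guarantees.\<close>
  define \<rho> where "\<rho> = 1 / (2 * m)"
  define h where "h z = f (z0 + of_real \<rho> * z)" for z
  define d where "d = m - g (z0 + of_real \<rho>)"
  have "g (z0 + of_real \<rho>) \<noteq> m"
    using z0(2)[of "z0 + of_real \<rho>"] m by (auto simp: \<rho>_def)
  then have d: "0 < d" using max[of "z0 + of_real \<rho>"] by (simp add: d_def)
  define s where "s = smul A (of_real \<rho>) (f z0)"
  have s: "qnrm s \<le> 1 / 2"
  proof -
    have "cmod (of_real \<rho>) * qnrm (f z0) = 1 / 2"
      using z0(1) m by (simp only: norm_of_real) (simp add: g_def \<rho>_def)
    then show ?thesis using qnrm_smul[of "of_real \<rho>" "f z0"] by (simp only: s_def)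
  qed
  have h: "mul A (h z) (e - smul A z s) - f z0 \<in> I" for z
  proof -
    define w where "w = of_real \<rho> * z"
    have "mul A (h z) (e - smul A w (f z0)) - f z0
        = mul A (f z0) (mul A (h z) (x - smul A (z0 + w) e) - e)
        - mul A (h z) (mul A (f z0) (x - smul A z0 e) - e)"
      by (simp add: mul_simps mul_unit mul_unit_right algebra_simps)
    also have "\<dots> \<in> I" unfolding h_def w_def by (intro diff_mem mul_mem f)
    finally show ?thesis by (simp add: s_def w_def mult.commute)
  qed
  have key: "d \<le> m * (real (2 ^ k) * (1/2) ^ 2 ^ k)" for k
  proof -
    define G where "G = root_avg k h 1"
    have "mul A G (e - smul A (1 ^ 2 ^ k) (repeated_square k s)) - f z0 \<in> I"
      unfolding G_def by (rule root_avg_resolvent) (auto intro: h)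
    then have "m = qnrm (mul A G (e - repeated_square k s))"
      using z0(1) by (simp add: g_def qnrm_cong)
    also have "\<dots> \<le> qnrm G * (qnrm e + qnrm (repeated_square k s))"
      by (rule order_trans[OF qnrm_mul]) (intro mult_left_mono qnrm_diff qnrm_nonneg)
    also have "\<dots> \<le> (m - d / 2 ^ k) * (1 + (1/2) ^ 2 ^ k)"
    proof (rule mult_mono)
      show le: "qnrm G \<le> m - d / 2 ^ k" unfolding G_def
        by (rule qnrm_root_avg_less) (use max in \<open>auto simp: h_def d_def g_def\<close>)
      show "qnrm e + qnrm (repeated_square k s) \<le> 1 + (1/2) ^ 2 ^ k"
        using qnrm_repeated_square[of k s] power_mono[OF s qnrm_nonneg, of "2 ^ k"] by (simp add: qnrm_unit)
      show "0 \<le> m - d / 2 ^ k" using le qnrm_nonneg[of G] by linarith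
      show "0 \<le> qnrm e + qnrm (repeated_square k s)" by (intro add_nonneg_nonneg qnrm_nonneg)
    qed
    finally have "d / 2 ^ k \<le> m * (1/2) ^ 2 ^ k - d / 2 ^ k * (1/2) ^ 2 ^ k"
      by (simp add: algebra_simps)
    moreover have "0 \<le> d / 2 ^ k * (1/2) ^ 2 ^ k" using d by simp
    ultimately have "d / 2 ^ k \<le> m * (1/2) ^ 2 ^ k" by linarith
    then have "d \<le> m * (1/2) ^ 2 ^ k * 2 ^ k" by (simp only: pos_divide_le_eq zero_less_power zero_less_numeral)
    then show ?thesis by (simp add: mult_ac)
  qed
  have "(\<lambda>n. real n * (1/2) ^ n) \<longlonglongrightarrow> 0"
    using powser_times_n_limit_0[of "1/2 :: real"] by simp
  then have "\<forall>\<^sub>F n in sequentially. real n * (1/2) ^ n < d / m"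
    by (rule order_tendstoD) (use d m in simp)
  then obtain N where "\<And>n. n \<ge> N \<Longrightarrow> real n * (1/2) ^ n < d / m"
    unfolding eventually_sequentially by blast
  moreover have "N \<le> 2 ^ N" by (rule less_imp_le[OF less_exp])
  ultimately have "real (2 ^ N) * (1/2) ^ 2 ^ N < d / m" by blast
  then have "m * (real (2 ^ N) * (1/2) ^ 2 ^ N) < d"
    using m by (simp only: pos_less_divide_eq mult.commute)
  with key[of N] show False by linarith
qed

lemma maximal_ideal:
  "\<exists>M. proper_ideal A e M \<and> I \<subseteq> M \<and> (\<forall>J. proper_ideal A e J \<longrightarrow> M \<subseteq> J \<longrightarrow> J = M)"
proof -
  define F where "F = {J. proper_ideal A e J \<and> I \<subseteq> J}"
  have "I \<in> F" using proper_ideal_axioms by (simp add: F_def)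
  moreover have "\<Union>K \<in> F" if K: "K \<noteq> {}" "subset.chain F K" for K
  proof -
    have sub: "K \<subseteq> F" and ch: "\<And>J J'. J \<in> K \<Longrightarrow> J' \<in> K \<Longrightarrow> J \<subseteq> J' \<or> J' \<subseteq> J"
      using K(2) by (auto simp: subset_chain_def)
    have id: "proper_ideal A e J" if "J \<in> K" for J using that sub by (auto simp: F_def)
    have "proper_ideal A e (\<Union>K)"
    proof
      show "0 \<in> \<Union>K" using K(1) id proper_ideal.zero_mem by blast
      show "e \<notin> \<Union>K" using id proper_ideal.unit_notin by blast
      show "mul A x y \<in> \<Union>K" if "y \<in> \<Union>K" for x y using that id proper_ideal.mul_mem by blast
      fix x y assume "x \<in> \<Union>K" "y \<in> \<Union>K"
      then obtain J where "J \<in> K" "x \<in> J" "y \<in> J" using ch by blast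
      then show "x + y \<in> \<Union>K" using proper_ideal.add_mem[OF id] by blast
    qed
    moreover have "I \<subseteq> \<Union>K" using K(1) sub by (auto simp: F_def)
    ultimately show ?thesis by (simp add: F_def)
  qed
  ultimately obtain M where "M \<in> F" "\<And>J. J \<in> F \<Longrightarrow> M \<subseteq> J \<Longrightarrow> J = M"
    using subset_Zorn_nonempty[of F] by blast
  then show ?thesis unfolding F_def by blast
qed

text \<open>
  Turns a failure of invertibility modulo \<open>I\<close> into a proper ideal containing both \<open>I\<close> and
  \<open>x\<close>, to which maximality or the existence of characters can be applied.
\<close>

lemma proper_ideal_adjoin:
  assumes "\<And>y. mul A y x - e \<notin> I"
  shows "proper_ideal A e {i. \<exists>y. i - mul A y x \<in> I}"
proof
  show "0 \<in> {i. \<exists>y. i - mul A y x \<in> I}"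
    using zero_mem by (intro CollectI exI[of _ 0]) simp
  show "e \<notin> {i. \<exists>y. i - mul A y x \<in> I}"
  proof
    assume "e \<in> {i. \<exists>y. i - mul A y x \<in> I}"
    then obtain y where "e - mul A y x \<in> I" by blast
    from uminus_mem[OF this] assms[of y] show False by simp
  qed
next
  fix i j assume "i \<in> {i. \<exists>y. i - mul A y x \<in> I}" "j \<in> {i. \<exists>y. i - mul A y x \<in> I}"
  then obtain y w where "i - mul A y x \<in> I" "j - mul A w x \<in> I" by blast
  from add_mem[OF this] have "i + j - mul A (y + w) x \<in> I"
    by (simp add: mul_add_left algebra_simps)
  then show "i + j \<in> {i. \<exists>y. i - mul A y x \<in> I}" by blast
next
  fix i c assume "i \<in> {i. \<exists>y. i - mul A y x \<in> I}"
  then obtain y where "i - mul A y x \<in> I" by blast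
  from mul_mem[OF this, of c] have "mul A c i - mul A (mul A c y) x \<in> I"
    by (simp add: mul_diff_right mul_assoc)
  then show "mul A c i \<in> {i. \<exists>y. i - mul A y x \<in> I}" by blast
qed

text \<open>
  If \<open>M\<close> is a maximal ideal containing \<open>I\<close>, then every \<open>x\<close> is congruent modulo \<open>M\<close>
  to a multiple of the unit: some \<open>x - z e\<close> is not invertible modulo \<open>M\<close>, and by maximality it
  lies in \<open>M\<close>.  The map \<open>x \<mapsto> z\<close> is the character.
\<close>

theorem ex_character_vanishing: "\<exists>\<phi>\<in>spectrum A. \<forall>i\<in>I. \<phi> i = 0"
proof -
  obtain M where M: "proper_ideal A e M" "I \<subseteq> M"
    and max: "\<And>J. proper_ideal A e J \<Longrightarrow> M \<subseteq> J \<Longrightarrow> J = M"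
    using maximal_ideal by metis
  interpret M: proper_ideal A e M by fact
  have "\<exists>z. x - smul A z e \<in> M" for x
  proof -
    obtain z where z: "\<And>y. mul A y (x - smul A z e) - e \<notin> M" using M.gelfand_mazur by blast
    let ?J = "{i. \<exists>y. i - mul A y (x - smul A z e) \<in> M}"
    have "M \<subseteq> ?J" by (intro subsetI CollectI exI[of _ 0]) simp
    then have "?J = M" by (rule max[OF M.proper_ideal_adjoin[OF z]])
    moreover have "x - smul A z e \<in> ?J"
      using M.zero_mem by (intro CollectI exI[of _ e]) (simp add: mul_unit)
    ultimately show ?thesis by blast
  qed
  then obtain \<phi> where \<phi>: "\<And>x. x - smul A (\<phi> x) e \<in> M" by metis
  have uniq: "\<phi> x = z" if "x - smul A z e \<in> M" for x z
  proof (rule ccontr)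
    assume ne: "\<phi> x \<noteq> z"
    have "smul A (1 / (\<phi> x - z)) ((x - smul A z e) - (x - smul A (\<phi> x) e)) \<in> M"
      by (intro M.smul_mem M.diff_mem \<phi> that)
    also have "smul A (1 / (\<phi> x - z)) ((x - smul A z e) - (x - smul A (\<phi> x) e)) = e"
    proof -
      have "(x - smul A z e) - (x - smul A (\<phi> x) e) = smul A (\<phi> x - z) e"
        by (simp add: scale_left_diff_distrib)
      then show ?thesis using ne by simp
    qed
    finally show False using M.unit_notin by simp
  qed
  have "\<phi> \<in> spectrum A"
  proof (rule spectrumI)
    show "\<phi> (x + y) = \<phi> x + \<phi> y" for x y
      using M.add_mem[OF \<phi>[of x] \<phi>[of y]] by (intro uniq) (simp add: scale_left_distrib add_diff_add)
    show "\<phi> (smul A c x) = c * \<phi> x" for c x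
      using M.smul_mem[OF \<phi>[of x], of c] by (intro uniq) (simp add: scale_right_diff_distrib)
    show "\<phi> (mul A x y) = \<phi> x * \<phi> y" for x y
    proof (rule uniq)
      have "mul A x y - smul A (\<phi> x * \<phi> y) e
          = mul A x (y - smul A (\<phi> y) e) + smul A (\<phi> y) (x - smul A (\<phi> x) e)"
        by (simp add: mul_simps mul_unit mul_unit_right)
      also have "\<dots> \<in> M" by (intro M.add_mem M.mul_mem M.smul_mem \<phi>)
      finally show "mul A x y - smul A (\<phi> x * \<phi> y) e \<in> M" .
    qed
    have "\<phi> e = 1" using M.zero_mem by (intro uniq) simp
    then show "\<phi> e \<noteq> 0" by simp
  qed
  moreover have "\<phi> i = 0" if "i \<in> I" for i
    using that M(2) by (intro uniq) auto
  ultimately show ?thesis by blast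
qed

end

section \<open>Limits in the quotient\<close>

context proper_ideal
begin

text \<open>
  Completeness of the quotient, tested on characters: a geometrically convergent sequence becomes a
  Cauchy sequence of the algebra itself after correction by elements of the ideal, which characters
  vanishing on the ideal do not see.
\<close>

lemma lift_limit:
  assumes step: "\<And>k. qnrm (x (Suc k) - x k) \<le> c * (1/2) ^ k"
  shows "\<exists>l. \<forall>\<phi>\<in>spectrum A. (\<forall>i\<in>I. \<phi> i = 0) \<longrightarrow> (\<lambda>k. \<phi> (x k)) \<longlonglongrightarrow> \<phi> l"
proof -
  have "\<exists>i\<in>I. nrm A (x (Suc k) - x k - i) < (c + 1) * (1/2) ^ k" for k
    using qnrm_approx[of "(1/2) ^ k" "x (Suc k) - x k"] step[of k]
    by (force simp: distrib_right)
  then obtain i where i: "\<And>k. i k \<in> I"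
    "\<And>k. nrm A (x (Suc k) - x k - i k) < (c + 1) * (1/2) ^ k" by metis
  define y where "y k = x k - (\<Sum>j<k. i j)" for k
  have y: "nrm A (y (Suc k) - y k) \<le> (c + 1) * (1/2) ^ k" for k
  proof -
    have "y (Suc k) - y k = x (Suc k) - x k - i k" by (simp add: y_def)
    then show ?thesis using i(2)[of k] by simp
  qed
  have "0 \<le> c + 1" using order_trans[OF nrm_nonneg y[of 0]] by simp
  have tail: "nrm A (y (n + p) - y n) \<le> 2 * (c + 1) * ((1/2) ^ n - (1/2) ^ (n + p))" for n p
  proof (induction p)
    case (Suc p)
    have "nrm A (y (n + Suc p) - y n)
        \<le> nrm A (y (Suc (n + p)) - y (n + p)) + nrm A (y (n + p) - y n)"
      using nrm_triangle[of "y (Suc (n + p)) - y (n + p)" "y (n + p) - y n"] by simp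
    moreover have "2 * (c + 1) * ((1/2) ^ n - (1/2) ^ (n + Suc p))
        = (c + 1) * (1/2) ^ (n + p) + 2 * (c + 1) * ((1/2) ^ n - (1/2) ^ (n + p))"
      by (simp add: power_add algebra_simps)
    ultimately show ?case using Suc y[of "n + p"] by linarith
  qed simp
  have bound: "nrm A (y m - y n) \<le> 2 * (c + 1) * (1/2) ^ min m n" for m n
  proof -
    have le: "nrm A (y m - y n) \<le> 2 * (c + 1) * (1/2) ^ n" if "n \<le> m" for m n
    proof -
      have "0 \<le> 2 * (c + 1) * (1/2) ^ m" using \<open>0 \<le> c + 1\<close> by simp
      with tail[of n "m - n"] that show ?thesis by (simp add: right_diff_distrib)
    qed
    show ?thesis
      using le[of n m] le[of m n] nrm_uminus[of "y m - y n"] by (cases "n \<le> m") (simp_all add: min_def)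
  qed
  have "\<exists>N. \<forall>m\<ge>N. \<forall>n\<ge>N. nrm A (y m - y n) < d" if "0 < d" for d
  proof -
    have "(\<lambda>n. 2 * (c + 1) * (1/2) ^ n) \<longlonglongrightarrow> 2 * (c + 1) * 0"
      by (intro tendsto_intros LIMSEQ_power_zero) simp
    then have "\<forall>\<^sub>F n in sequentially. 2 * (c + 1) * (1/2) ^ n < d"
      by (rule order_tendstoD) (simp add: that)
    then obtain N where N: "\<And>n. n \<ge> N \<Longrightarrow> 2 * (c + 1) * (1/2) ^ n < d"
      unfolding eventually_sequentially by blast
    have "nrm A (y m - y n) < d" if "m \<ge> N" "n \<ge> N" for m n
      using bound[of m n] N[of "min m n"] that by simp
    then show ?thesis by blast
  qed
  from nrm_complete[OF this]
  obtain l where l: "\<And>d. d > 0 \<Longrightarrow> \<exists>N. \<forall>n\<ge>N. nrm A (y n - l) < d" by blast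
  have "(\<lambda>k. \<phi> (x k)) \<longlonglongrightarrow> \<phi> l" if \<phi>: "\<phi> \<in> spectrum A" and van: "\<forall>i\<in>I. \<phi> i = 0" for \<phi>
  proof -
    have sum: "\<phi> (\<Sum>j<k. i j) = 0" for k
      by (induction k) (simp_all add: character_simps[OF \<phi>] van i)
    have "cmod (\<phi> (x k) - \<phi> l) \<le> nrm A (y k - l)" for k
      using character_bounded[OF \<phi>, of "y k - l"]
      by (simp add: y_def character_simps[OF \<phi>] sum)
    then show ?thesis
      unfolding LIMSEQ_iff using l by (meson le_less_trans)
  qed
  then show ?thesis by blast
qed

lemma character_repeated_square:
  assumes "\<phi> \<in> spectrum A"
  shows "\<phi> (repeated_square k x) = \<phi> x ^ 2 ^ k"
  by (induction k) (simp_all add: character_simps[OF assms] mult_2 power_add)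

end

section \<open>Adjoining a unit\<close>

definition complex_alg :: "complex alg"
  where "complex_alg = \<lparr> smul = (*), mul = (*), nrm = cmod \<rparr>"

text \<open>
  The unitization is itself a duplication, by the complex numbers acting as scalars.
\<close>

definition unitization :: "'a::ab_group_add alg \<Rightarrow> ('a \<times> complex) alg"
  where "unitization A = duplication A complex_alg (smul A) (\<lambda>a c. smul A c a)"

lemma complex_alg_simps [simp]:
  "smul complex_alg = (*)" "mul complex_alg = (*)" "nrm complex_alg = cmod"
  by (simp_all add: complex_alg_def)

lemma unitization_simps [simp]:
  "smul (unitization A) c (x, z) = (smul A c x, c * z)"
  "mul (unitization A) (x, z) (y, w) = (mul A x y + smul A w x + smul A z y, z * w)"
  "nrm (unitization A) (x, z) = nrm A x + cmod z"
  by (simp_all add: unitization_def duplication_def)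

lemma comm_banach_algebra_complex: "comm_banach_algebra complex_alg"
proof -
  have vs: "vector_space ((*) :: complex \<Rightarrow> complex \<Rightarrow> complex)"
    by unfold_locales (simp_all add: algebra_simps)
  have "Met_TC.mcomplete TYPE(complex)"
    by (simp add: complete_UNIV)
  then have "Metric_space.mcomplete UNIV (\<lambda>x y :: complex. cmod (x - y))"
    by (simp add: dist_norm[abs_def])
  then show ?thesis
    by (intro comm_banach_algebra.intro complex_banach_algebra.intro complex_banach_space.intro
        complex_banach_space_axioms.intro complex_banach_algebra_axioms.intro
        comm_banach_algebra_axioms.intro)
      (simp_all add: vs norm_triangle_ineq norm_mult Vector_Spaces.linear_iff algebra_simps)
qed

context comm_banach_algebra
begin

lemma unital_unitization: "unital_comm_banach_algebra (unitization A) (0, 1)"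
proof -
  interpret C: comm_banach_algebra complex_alg by (rule comm_banach_algebra_complex)
  have "banach_bimodule A complex_alg (smul A) (\<lambda>a c. smul A c a)"
    by unfold_locales
      (simp_all add: scale_right_distrib scale_left_distrib nrm_smul mult.commute
        scale_left_commute)
  then interpret U: comm_banach_algebra "unitization A"
    unfolding unitization_def
    by (intro comm_banach_algebra_duplication comm_banach_algebra_axioms C.comm_banach_algebra_axioms)
      (simp_all add: symmetric_actions_def compatible_actions_def mul_smul_left mul_smul_right)
  show ?thesis
    by unfold_locales (auto simp: zero_prod_def)
qed

lemma unitization_characterI:
  assumes "\<phi> \<in> spectrum A \<or> \<phi> = (\<lambda>_. 0)"
  shows "(\<lambda>(x, z). \<phi> x + z) \<in> spectrum (unitization A)"
proof -
  interpret U: unital_comm_banach_algebra "unitization A" "(0, 1)" by (rule unital_unitization)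
  have ch: "\<phi> (x + y) = \<phi> x + \<phi> y" "\<phi> (smul A c x) = c * \<phi> x" "\<phi> (mul A x y) = \<phi> x * \<phi> y"
    "\<phi> 0 = 0" for x y c
    using assms character_simps by auto
  show ?thesis
    by (rule U.spectrumI[where x = "(0, 1)"]) (auto simp: ch algebra_simps)
qed

lemma spectrum_restrict_unitization:
  assumes "\<phi> \<in> spectrum (unitization A)" "\<phi> (x, 0) \<noteq> 0"
  shows "(\<lambda>x. \<phi> (x, 0)) \<in> spectrum A"
proof -
  interpret U: unital_comm_banach_algebra "unitization A" "(0, 1)" by (rule unital_unitization)
  note ch = U.character_simps[OF assms(1)]
  show ?thesis
  proof (rule spectrumI[where x = x])
    show "\<phi> (x + y, 0) = \<phi> (x, 0) + \<phi> (y, 0)" for x y using ch(1)[of "(x, 0)" "(y, 0)"] by simp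
    show "\<phi> (smul A c x, 0) = c * \<phi> (x, 0)" for c x using ch(2)[of c "(x, 0)"] by simp
    show "\<phi> (mul A x y, 0) = \<phi> (x, 0) * \<phi> (y, 0)" for x y using ch(3)[of "(x, 0)" "(y, 0)"] by simp
  qed (use assms in simp)
qed

section \<open>Local units in regular algebras\<close>

text \<open>
  With \<open>b = a / r\<close> and \<open>r < \<epsilon>\<close>, the averages of \<open>(1 - z b)^(-1)\<close> over
  \<open>2^k\<close> points of the unit circle are \<open>(1 - b^(2^k))^(-1)\<close> modulo \<open>I\<close>, and they
  converge.  A character in \<open>N\<close> has \<open>\<bar>\<phi> b\<bar> > 1\<close> and maps the limit \<open>l\<close>
  to \<open>0\<close>; the character that kills \<open>A\<close> maps it to \<open>1\<close>.  Hence
  \<open>l = 1 - u\<close> with \<open>u\<close> in \<open>A\<close> as required.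
\<close>

theorem regular_local_unit:
  assumes reg: "regular A" and \<epsilon>: "0 < \<epsilon>"
  shows "\<exists>u. \<forall>\<phi>\<in>spectrum A. \<epsilon> \<le> cmod (\<phi> a) \<longrightarrow> \<phi> u = 1"
proof -
  interpret U: unital_comm_banach_algebra "unitization A" "(0, 1)" by (rule unital_unitization)
  define N where "N = {\<phi>\<in>spectrum A. \<epsilon> \<le> cmod (\<phi> a)}"
  define I where "I = {(x, 0::complex) |x. \<forall>\<phi>\<in>N. \<phi> x = 0}"
  have N: "\<phi> (x + y) = \<phi> x + \<phi> y" "\<phi> (smul A c x) = c * \<phi> x" "\<phi> (mul A x y) = \<phi> x * \<phi> y"
    "\<phi> 0 = 0" if "\<phi> \<in> N" for \<phi> x y c
    using that character_simps by (auto simp: N_def)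
  interpret I: proper_ideal "unitization A" "(0, 1)" I
  proof
    show "0 \<in> I" using N(4) by (simp add: I_def zero_prod_def)
    show "p + q \<in> I" if "p \<in> I" "q \<in> I" for p q using that N(1) by (force simp: I_def)
    show "mul (unitization A) p q \<in> I" if q: "q \<in> I" for p q
    proof -
      obtain x where x: "q = (x, 0)" "\<And>\<phi>. \<phi> \<in> N \<Longrightarrow> \<phi> x = 0" using q unfolding I_def by blast
      obtain y w where p: "p = (y, w)" by fastforce
      have "\<phi> (mul A y x + smul A w x) = 0" if "\<phi> \<in> N" for \<phi>
        by (simp only: N(1-3)[OF that] x(2)[OF that]) simp
      then show ?thesis by (auto simp: I_def p x(1))
    qed
    show "(0, 1) \<notin> I" by (simp add: I_def)
  qed
  let ?e = "(0, 1) :: 'a \<times> complex"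
  define r where "r = \<epsilon> / 2"
  define b where "b = (smul A (1 / of_real r) a, 0 :: complex)"
  have r: "0 < r" "r < \<epsilon>" using \<epsilon> by (simp_all add: r_def)
  \<comment> \<open>Otherwise some character vanishing on \<open>I\<close> has modulus \<open>r\<close> at \<open>a\<close>, strictly between \<open>0\<close> and \<open>\<epsilon>\<close>; regularity excludes it.\<close>
  have "\<exists>y. mul (unitization A) y (?e - smul (unitization A) z b) - ?e \<in> I" if z: "cmod z = 1" for z
  proof (rule ccontr)
    let ?x = "?e - smul (unitization A) z b"
    let ?J = "{i. \<exists>y. i - mul (unitization A) y ?x \<in> I}"
    assume "\<not> ?thesis"
    then interpret J: proper_ideal "unitization A" ?e ?J
      by (intro I.proper_ideal_adjoin) blast
    obtain \<phi> where \<phi>: "\<phi> \<in> spectrum (unitization A)" and van: "\<forall>i\<in>?J. \<phi> i = 0"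
      using J.ex_character_vanishing by blast
    note ch = U.character_simps[OF \<phi>]
    have "?x \<in> ?J" using I.zero_mem
      by (intro CollectI exI[of _ ?e]) (simp only: U.mul_unit diff_self)
    then have "\<phi> ?x = 0" by (rule van[THEN bspec])
    then have "z * \<phi> b = 1" by (simp add: ch U.character_unit[OF \<phi>])
    moreover have "\<phi> b = \<phi> (a, 0) / r"
      using ch(2)[of "1 / of_real r" "(a, 0)"] by (simp add: b_def)
    ultimately have a: "z * \<phi> (a, 0) = of_real r" using r by (simp add: field_simps)
    then have "cmod (z * \<phi> (a, 0)) = r" using r by simp
    then have cm: "cmod (\<phi> (a, 0)) = r" using z by (simp add: norm_mult)
    define \<psi> where "\<psi> x = \<phi> (x, 0)" for x
    have "\<phi> (a, 0) \<noteq> 0" using cm r by auto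
    then have \<psi>: "\<psi> \<in> spectrum A"
      unfolding \<psi>_def by (rule spectrum_restrict_unitization[OF \<phi>])
    have "\<exists>c. \<psi> c \<noteq> 0 \<and> (\<forall>\<phi>\<in>spectrum A. (\<exists>x\<in>{a}. \<epsilon> - r \<le> cmod (\<phi> x - \<psi> x)) \<longrightarrow> \<phi> c = 0)"
      by (rule regularD[OF reg \<psi>]) (use r in auto)
    then obtain c where c: "\<psi> c \<noteq> 0"
      "\<And>\<phi>. \<phi> \<in> spectrum A \<Longrightarrow> \<epsilon> - r \<le> cmod (\<phi> a - \<psi> a) \<Longrightarrow> \<phi> c = 0"
      by blast
    have "(c, 0) \<in> I"
    proof -
      have "\<eta> c = 0" if "\<eta> \<in> N" for \<eta>
        using that norm_triangle_ineq2[of "\<eta> a" "\<psi> a"] cm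
        by (intro c(2)) (auto simp: N_def \<psi>_def)
      then show ?thesis by (auto simp: I_def)
    qed
    then have "(c, 0) \<in> ?J" by (intro CollectI exI[of _ 0]) simp
    from van[THEN bspec, OF this] c(1) show False by (simp add: \<psi>_def)
  qed
  then obtain f where f: "\<And>z. cmod z = 1 \<Longrightarrow>
      mul (unitization A) (f z) (?e - smul (unitization A) z b) - ?e \<in> I"
    by metis
  have "continuous_on (sphere 0 1) (\<lambda>z. I.qnrm (f z))"
    by (rule I.continuous_qnrm_resolvent[of _ f ?e b]) (simp add: f)
  then have "bounded ((\<lambda>z. I.qnrm (f z)) ` sphere 0 1)"
    by (intro compact_imp_bounded compact_continuous_image compact_sphere)
  then obtain C where "\<And>z. z \<in> sphere 0 1 \<Longrightarrow> norm (I.qnrm (f z)) \<le> C"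
    unfolding bounded_iff by blast
  then have C: "I.qnrm (f z) \<le> C" if "cmod z = 1" for z using that by (force simp: abs_le_iff)
  have C0: "0 \<le> C" using I.qnrm_nonneg[of "f 1"] C[of 1] by simp
  define L where "L = I.qnrm b * (C * C)"
  have L: "0 \<le> L" using C0 I.qnrm_nonneg[of b] by (simp add: L_def)
  have lip: "I.qnrm (f z - f w) \<le> L * cmod (z - w)" if "cmod z = 1" "cmod w = 1" for z w
  proof -
    have "I.qnrm (f z - f w) \<le> cmod (z - w) * I.qnrm b * (I.qnrm (f z) * I.qnrm (f w))"
      by (rule I.resolvent_diff[OF f f]) (use that in simp_all)
    also have "\<dots> \<le> cmod (z - w) * I.qnrm b * (C * C)"
      by (intro mult_left_mono mult_mono mult_nonneg_nonneg C C0 I.qnrm_nonneg that) simp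
    finally show ?thesis by (simp add: L_def mult_ac)
  qed
  obtain l where l: "\<And>\<phi>. \<phi> \<in> spectrum (unitization A) \<Longrightarrow> \<forall>i\<in>I. \<phi> i = 0 \<Longrightarrow>
      (\<lambda>k. \<phi> (I.root_avg k f 1)) \<longlonglongrightarrow> \<phi> l"
    using I.lift_limit[of "\<lambda>k. I.root_avg k f 1", OF I.qnrm_root_avg_step[OF lip L]] by blast
  have val: "\<phi> (I.root_avg k f 1) * (1 - \<phi> b ^ 2 ^ k) = 1"
    if \<phi>: "\<phi> \<in> spectrum (unitization A)" and van: "\<forall>i\<in>I. \<phi> i = 0" for \<phi> k
  proof -
    have "mul (unitization A) (I.root_avg k f 1)
        (?e - smul (unitization A) (1 ^ 2 ^ k) (I.repeated_square k b)) - ?e \<in> I"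
      by (rule I.root_avg_resolvent[OF f]) simp_all
    with van have "\<phi> (mul (unitization A) (I.root_avg k f 1)
        (?e - smul (unitization A) (1 ^ 2 ^ k) (I.repeated_square k b)) - ?e) = 0" by blast
    then show ?thesis
      by (simp add: U.character_simps[OF \<phi>] U.character_unit[OF \<phi>] I.character_repeated_square[OF \<phi>])
  qed
  obtain v w where vw: "l = (v, w)" by fastforce
  have "w = 1"
  proof -
    let ?\<phi> = "\<lambda>(x::'a, z::complex). 0 + z"
    have \<phi>: "?\<phi> \<in> spectrum (unitization A)"
      using unitization_characterI[of "\<lambda>_. 0"] by simp
    have van: "\<forall>i\<in>I. ?\<phi> i = 0" by (auto simp: I_def)
    have "?\<phi> (I.root_avg k f 1) = 1" for k
      using val[OF \<phi> van, of k] by (simp add: b_def zero_power)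
    then have "(\<lambda>k. ?\<phi> (I.root_avg k f 1)) \<longlonglongrightarrow> 1" by simp
    then have "?\<phi> l = 1" using l[OF \<phi> van] LIMSEQ_unique by blast
    then show ?thesis by (simp add: vw)
  qed
  have "\<phi> (- v) = 1" if \<phi>: "\<phi> \<in> spectrum A" and big: "\<epsilon> \<le> cmod (\<phi> a)" for \<phi>
  proof -
    let ?\<phi> = "\<lambda>(x::'a, z::complex). \<phi> x + z"
    have ch: "?\<phi> \<in> spectrum (unitization A)"
      using unitization_characterI \<phi> by blast
    have van: "\<forall>i\<in>I. ?\<phi> i = 0" using \<phi> big by (auto simp: I_def N_def)
    define t where "t = ?\<phi> b"
    have "cmod t = cmod (\<phi> a) / r"
      using r by (simp add: t_def b_def character_simps[OF \<phi>] norm_divide)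
    moreover have "2 \<le> cmod (\<phi> a) / r" using big r by (simp add: r_def pos_le_divide_eq)
    ultimately have t: "2 \<le> cmod t" by simp
    have decay: "cmod (?\<phi> (I.root_avg k f 1)) \<le> (1/2) ^ k" for k
    proof -
      have "2 ^ k + 1 \<le> (2::real) ^ Suc k" by simp
      also have "\<dots> \<le> 2 ^ 2 ^ k"
        by (intro power_increasing) (simp_all add: Suc_leI less_exp)
      also have "\<dots> \<le> cmod t ^ 2 ^ k" by (intro power_mono t) simp
      also have "\<dots> = cmod (t ^ 2 ^ k)" by (simp add: norm_power)
      finally have "2 ^ k \<le> cmod (1 - t ^ 2 ^ k)"
        using norm_triangle_ineq2[of "t ^ 2 ^ k" 1] by (simp add: norm_minus_commute)
      then have "cmod (?\<phi> (I.root_avg k f 1)) * 2 ^ k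
          \<le> cmod (?\<phi> (I.root_avg k f 1)) * cmod (1 - t ^ 2 ^ k)"
        by (intro mult_left_mono) simp_all
      also have "\<dots> = cmod (?\<phi> (I.root_avg k f 1) * (1 - t ^ 2 ^ k))" by (simp only: norm_mult)
      also have "\<dots> = 1" unfolding t_def val[OF ch van] by simp
      finally show ?thesis by (simp add: power_one_over field_simps)
    qed
    have "(\<lambda>k. (1/2 :: real) ^ k) \<longlonglongrightarrow> 0" by (intro LIMSEQ_power_zero) simp
    then have "(\<lambda>k. ?\<phi> (I.root_avg k f 1)) \<longlonglongrightarrow> 0"
      by (rule Lim_null_comparison[OF always_eventually[OF allI[OF decay]]])
    then have "?\<phi> l = 0" using l[OF ch van] LIMSEQ_unique by blast
    then have "\<phi> v = - 1" using \<open>w = 1\<close> by (simp add: vw eq_neg_iff_add_eq_0)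
    then show ?thesis using character_simps(5)[OF \<phi>, of 0 v] character_simps(4)[OF \<phi>] by simp
  qed
  then show ?thesis by blast
qed

end

section \<open>The spectrum of the duplication\<close>

locale symmetric_banach_bimodule =
  A: comm_banach_algebra A + B: comm_banach_algebra B + banach_bimodule A B lact ract
  for A :: "'a::ab_group_add alg" and B :: "'b::ab_group_add alg"
    and lact :: "'b \<Rightarrow> 'a \<Rightarrow> 'a" and ract :: "'a \<Rightarrow> 'b \<Rightarrow> 'a" +
  assumes symmetric: "symmetric_actions lact ract"
    and compatible: "compatible_actions A lact ract"
begin

abbreviation D :: "('a \<times> 'b) alg" where "D \<equiv> duplication A B lact ract"

sublocale D: comm_banach_algebra D
  by (rule comm_banach_algebra_duplication[OF A.comm_banach_algebra_axioms
        B.comm_banach_algebra_axioms banach_bimodule_axioms symmetric compatible])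

lemma lact_simps:
  "lact b (x + y) = lact b x + lact b y" "lact b (smul A c x) = smul A c (lact b x)"
  "lact (b + b') x = lact b x + lact b' x" "lact (smul B c b) x = smul A c (lact b x)"
  "lact b 0 = 0" "lact 0 x = 0"
proof -
  show l: "lact b (x + y) = lact b x + lact b y" "lact b (smul A c x) = smul A c (lact b x)" for b x y c
    using lact_linear_right[of b] by (simp_all add: Vector_Spaces.linear_iff)
  show r: "lact (b + b') x = lact b x + lact b' x" "lact (smul B c b) x = smul A c (lact b x)" for b b' x c
    using lact_linear_left[of x] by (simp_all add: Vector_Spaces.linear_iff)
  show "lact b 0 = 0" "lact 0 x = 0" using l(1)[of b 0 0] r(1)[of 0 0 x] by simp_all
qed

lemma ract_eq: "ract a b = lact b a"
  using symmetric by (simp add: symmetric_actions_def)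

lemma lact_compatible: "mul A (lact b x) y = mul A x (lact b y)"
  using compatible by (simp add: compatible_actions_def ract_eq)

lemma duplication_simps:
  "smul D c (a, b) = (smul A c a, smul B c b)"
  "mul D (a, b) (a', b') = (mul A a a' + lact b' a + lact b a', mul B b b')"
  by (simp_all add: duplication_def ract_eq)

lemma restrict_left:
  assumes \<Phi>: "\<Phi> \<in> spectrum D"
  shows "(\<lambda>a. \<Phi> (a, 0)) \<in> spectrum A \<or> (\<forall>a. \<Phi> (a, 0) = 0)"
proof (cases "\<forall>a. \<Phi> (a, 0) = 0")
  case False
  then obtain a where a: "\<Phi> (a, 0) \<noteq> 0" by blast
  note ch = D.character_simps[OF \<Phi>]
  have "(\<lambda>a. \<Phi> (a, 0)) \<in> spectrum A"
  proof (rule A.spectrumI[where x = a])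
    show "\<Phi> (x + y, 0) = \<Phi> (x, 0) + \<Phi> (y, 0)" for x y using ch(1)[of "(x, 0)" "(y, 0)"] by simp
    show "\<Phi> (smul A c x, 0) = c * \<Phi> (x, 0)" for c x
      using ch(2)[of c "(x, 0)"] by (simp add: duplication_simps)
    show "\<Phi> (mul A x y, 0) = \<Phi> (x, 0) * \<Phi> (y, 0)" for x y
      using ch(3)[of "(x, 0)" "(y, 0)"] by (simp add: duplication_simps lact_simps)
  qed (rule a)
  then show ?thesis ..
qed simp

lemma restrict_right:
  assumes \<Phi>: "\<Phi> \<in> spectrum D"
  shows "(\<lambda>b. \<Phi> (0, b)) \<in> spectrum B \<or> (\<forall>b. \<Phi> (0, b) = 0)"
proof (cases "\<forall>b. \<Phi> (0, b) = 0")
  case False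
  then obtain b where b: "\<Phi> (0, b) \<noteq> 0" by blast
  note ch = D.character_simps[OF \<Phi>]
  have "(\<lambda>b. \<Phi> (0, b)) \<in> spectrum B"
  proof (rule B.spectrumI[where x = b])
    show "\<Phi> (0, x + y) = \<Phi> (0, x) + \<Phi> (0, y)" for x y using ch(1)[of "(0, x)" "(0, y)"] by simp
    show "\<Phi> (0, smul B c x) = c * \<Phi> (0, x)" for c x
      using ch(2)[of c "(0, x)"] by (simp add: duplication_simps)
    show "\<Phi> (0, mul B x y) = \<Phi> (0, x) * \<Phi> (0, y)" for x y
      using ch(3)[of "(0, x)" "(0, y)"] by (simp add: duplication_simps lact_simps)
  qed (rule b)
  then show ?thesis ..
qed simp

lemma character_split: "\<Phi> \<in> spectrum D \<Longrightarrow> \<Phi> (a, b) = \<Phi> (a, 0) + \<Phi> (0, b)"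
  using D.character_simps(1)[of \<Phi> "(a, 0)" "(0, b)"] by simp

lemma lift_right:
  assumes "\<psi> \<in> spectrum B"
  shows "(\<lambda>(a, b). \<psi> b) \<in> spectrum D"
proof -
  obtain b where "\<psi> b = 1" using B.character_nonzero[OF assms] .
  then show ?thesis
    by (intro D.spectrumI[where x = "(0, b)"])
      (auto simp: duplication_simps B.character_simps[OF assms])
qed

text \<open>
  Choose \<open>u\<close> with \<open>\<phi> u = 1\<close> and put \<open>\<psi> b = \<phi> (b \<cdot> u)\<close>.
  Compatibility gives \<open>(b \<cdot> a) u = a (b \<cdot> u)\<close>, hence
  \<open>\<phi> (b \<cdot> a) = \<psi> b * \<phi> a\<close>, from which multiplicativity of \<open>\<psi>\<close> and of
  \<open>\<phi> a + \<psi> b\<close> follows.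
\<close>

lemma extend_left:
  assumes \<phi>: "\<phi> \<in> spectrum A"
  shows "\<exists>\<Phi>\<in>spectrum D. \<forall>a. \<Phi> (a, 0) = \<phi> a"
proof -
  note ch = A.character_simps[OF \<phi>]
  obtain u where u: "\<phi> u = 1" using A.character_nonzero[OF \<phi>] .
  define \<psi> where "\<psi> b = \<phi> (lact b u)" for b
  have act: "\<phi> (lact b a) = \<psi> b * \<phi> a" for a b
  proof -
    have "\<phi> (lact b a) = \<phi> (mul A (lact b a) u)" by (simp add: ch u)
    also have "\<dots> = \<phi> a * \<psi> b" unfolding lact_compatible by (simp add: ch \<psi>_def)
    finally show ?thesis by (simp add: mult.commute)
  qed
  have \<psi>: "\<psi> (x + y) = \<psi> x + \<psi> y" "\<psi> (smul B c x) = c * \<psi> x" "\<psi> (mul B x y) = \<psi> x * \<psi> y" for x y c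
  proof -
    show "\<psi> (x + y) = \<psi> x + \<psi> y" "\<psi> (smul B c x) = c * \<psi> x"
      by (simp_all add: \<psi>_def lact_simps ch)
    have "\<psi> (mul B x y) = \<phi> (lact x (lact y u))" by (simp add: \<psi>_def lact_mul)
    then show "\<psi> (mul B x y) = \<psi> x * \<psi> y" by (simp add: act u)
  qed
  have \<psi>0: "\<psi> 0 = 0" by (simp add: \<psi>_def lact_simps ch)
  have "(\<lambda>(a, b). \<phi> a + \<psi> b) \<in> spectrum D"
    by (rule D.spectrumI[where x = "(u, 0)"])
      (auto simp: duplication_simps ch act \<psi> u \<psi>0 algebra_simps)
  then show ?thesis by (rule bexI[rotated]) (simp add: \<psi>0)
qed

section \<open>Semisimplicity\<close>

theorem semisimple_duplication: "semisimple D \<longleftrightarrow> semisimple A \<and> semisimple B"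
  unfolding D.semisimple_iff A.semisimple_iff B.semisimple_iff
proof (intro iffI conjI allI impI)
  assume D: "\<forall>p. (\<forall>\<Phi>\<in>spectrum D. \<Phi> p = 0) \<longrightarrow> p = 0"
  show "a = 0" if "\<forall>\<phi>\<in>spectrum A. \<phi> a = 0" for a
  proof -
    have "\<forall>\<Phi>\<in>spectrum D. \<Phi> (a, 0) = 0" using restrict_left that by fastforce
    then show ?thesis using D by (metis zero_prod_def prod.inject)
  qed
  show "b = 0" if "\<forall>\<psi>\<in>spectrum B. \<psi> b = 0" for b
  proof -
    have "\<forall>\<Phi>\<in>spectrum D. \<Phi> (0, b) = 0" using restrict_right that by fastforce
    then show ?thesis using D by (metis zero_prod_def prod.inject)
  qed
next
  fix p :: "'a \<times> 'b"
  assume "(\<forall>a. (\<forall>\<phi>\<in>spectrum A. \<phi> a = 0) \<longrightarrow> a = 0) \<and>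
      (\<forall>b. (\<forall>\<psi>\<in>spectrum B. \<psi> b = 0) \<longrightarrow> b = 0)"
  then have A: "\<And>a. \<forall>\<phi>\<in>spectrum A. \<phi> a = 0 \<Longrightarrow> a = 0"
    and B: "\<And>b. \<forall>\<psi>\<in>spectrum B. \<psi> b = 0 \<Longrightarrow> b = 0" by simp_all
  assume p: "\<forall>\<Phi>\<in>spectrum D. \<Phi> p = 0"
  obtain a b where ab: "p = (a, b)" by fastforce
  have "\<psi> b = 0" if "\<psi> \<in> spectrum B" for \<psi>
    using p[THEN bspec, OF lift_right[OF that]] by (simp add: ab)
  then have "b = 0" by (intro B ballI)
  moreover have "\<phi> a = 0" if \<phi>: "\<phi> \<in> spectrum A" for \<phi>
  proof -
    obtain \<Phi> where \<Phi>: "\<Phi> \<in> spectrum D" "\<forall>a. \<Phi> (a, 0) = \<phi> a"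
      using extend_left[OF \<phi>] by (rule bexE)
    from p[THEN bspec, OF \<Phi>(1)] \<Phi>(2) show ?thesis by (simp add: ab \<open>b = 0\<close>)
  qed
  then have "a = 0" by (intro A ballI)
  ultimately show "p = 0" by (simp add: ab zero_prod_def)
qed

section \<open>Regularity\<close>

text \<open>
  A separating element \<open>c\<close> of the duplication is moved into the ideal \<open>A\<close> by multiplying it with
  some \<open>u\<close> in \<open>A\<close> that \<open>\<phi>0\<close> maps to \<open>1\<close>.
\<close>

lemma regular_left:
  assumes reg: "regular D"
  shows "regular A"
  unfolding regular_iff
proof (intro ballI allI impI, elim conjE)
  fix \<phi>0 and X :: "'a set" and e :: real
  assume \<phi>0: "\<phi>0 \<in> spectrum A" and X: "finite X" and e: "0 < e"
  obtain u where u: "\<phi>0 u = 1" using A.character_nonzero[OF \<phi>0] .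
  obtain \<Phi>0 where \<Phi>0: "\<Phi>0 \<in> spectrum D" and \<Phi>0_left: "\<forall>a. \<Phi>0 (a, 0) = \<phi>0 a"
    using extend_left[OF \<phi>0] by (rule bexE)
  obtain c where c: "\<Phi>0 c \<noteq> 0"
    "\<And>\<Phi>. \<Phi> \<in> spectrum D \<Longrightarrow> \<exists>x\<in>(\<lambda>x. (x, 0)) ` X. e \<le> cmod (\<Phi> x - \<Phi>0 x) \<Longrightarrow> \<Phi> c = 0"
    using regularD[OF reg \<Phi>0 finite_imageI[OF X, of "\<lambda>x. (x, 0)"] e] by blast
  obtain v where v: "mul D c (u, 0) = (v, 0)"
    by (cases c) (simp add: duplication_simps)
  have "\<phi>0 v = \<Phi>0 c"
    using D.character_simps(3)[OF \<Phi>0, of c "(u, 0)"] by (simp add: v \<Phi>0_left u)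
  moreover have "\<phi> v = 0" if \<phi>: "\<phi> \<in> spectrum A" "\<exists>x\<in>X. e \<le> cmod (\<phi> x - \<phi>0 x)" for \<phi>
  proof -
    obtain \<Phi> where \<Phi>: "\<Phi> \<in> spectrum D" and \<Phi>_left: "\<forall>a. \<Phi> (a, 0) = \<phi> a"
      using extend_left[OF \<phi>(1)] by (rule bexE)
    have "\<Phi> c = 0" using \<phi>(2) by (intro c(2) \<Phi>) (auto simp: \<Phi>_left \<Phi>0_left)
    then show ?thesis
      using D.character_simps(3)[OF \<Phi>, of c "(u, 0)"] by (simp add: v \<Phi>_left)
  qed
  ultimately show "\<exists>c. \<phi>0 c \<noteq> 0 \<and>
      (\<forall>\<phi>\<in>spectrum A. (\<exists>x\<in>X. e \<le> cmod (\<phi> x - \<phi>0 x)) \<longrightarrow> \<phi> c = 0)"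
    using c(1) by (intro exI[of _ v]) auto
qed

lemma regular_right:
  assumes reg: "regular D"
  shows "regular B"
  unfolding regular_iff
proof (intro ballI allI impI, elim conjE)
  fix \<psi>0 and X :: "'b set" and e :: real
  assume \<psi>0: "\<psi>0 \<in> spectrum B" and X: "finite X" and e: "0 < e"
  obtain c where c: "(\<lambda>(a, b). \<psi>0 b) c \<noteq> 0"
    "\<And>\<Phi>. \<Phi> \<in> spectrum D \<Longrightarrow>
      \<exists>x\<in>(\<lambda>x. (0, x)) ` X. e \<le> cmod (\<Phi> x - (\<lambda>(a, b). \<psi>0 b) x) \<Longrightarrow> \<Phi> c = 0"
    using regularD[OF reg lift_right[OF \<psi>0] finite_imageI[OF X, of "\<lambda>x. (0, x)"] e] by blast
  have "\<psi> (snd c) = 0" if \<psi>: "\<psi> \<in> spectrum B" "\<exists>x\<in>X. e \<le> cmod (\<psi> x - \<psi>0 x)" for \<psi>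
    using c(2)[OF lift_right[OF \<psi>(1)]] \<psi>(2) by (auto simp: case_prod_unfold)
  then show "\<exists>c. \<psi>0 c \<noteq> 0 \<and>
      (\<forall>\<psi>\<in>spectrum B. (\<exists>x\<in>X. e \<le> cmod (\<psi> x - \<psi>0 x)) \<longrightarrow> \<psi> c = 0)"
    using c(1) by (intro exI[of _ "snd c"]) (auto simp: case_prod_unfold)
qed

text \<open>
  A character \<open>\<Phi>\<close> with \<open>\<Phi> u \<noteq> 0\<close> for some \<open>u\<close> in \<open>A\<close> is determined
  by its restriction to \<open>A\<close>, because \<open>p u\<close> is in \<open>A\<close> for all \<open>p\<close>.  So
  closeness of \<open>\<Phi>\<close> to \<open>\<Phi>0\<close> at \<open>p\<close> can be tested at \<open>u\<close> and at
  \<open>v p = p u - \<Phi>0 p u\<close>, and a separating element can be taken from \<open>A\<close>.  Such an element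
  vanishes automatically at the characters that are zero on \<open>A\<close>.
\<close>

lemma separate_left:
  assumes reg: "regular A" and \<Phi>0: "\<Phi>0 \<in> spectrum D" and "(\<lambda>a. \<Phi>0 (a, 0)) \<in> spectrum A"
    and X: "finite X" and e: "(0::real) < e"
  shows "\<exists>c. \<Phi>0 c \<noteq> 0 \<and> (\<forall>\<Phi>\<in>spectrum D. (\<exists>x\<in>X. e \<le> cmod (\<Phi> x - \<Phi>0 x)) \<longrightarrow> \<Phi> c = 0)"
proof -
  define \<phi>0 where "\<phi>0 a = \<Phi>0 (a, 0)" for a
  have \<phi>0: "\<phi>0 \<in> spectrum A" using assms(3) by (simp add: \<phi>0_def[abs_def])
  obtain u where u: "\<phi>0 u = 1" using A.character_nonzero[OF \<phi>0] .
  define v where "v p = fst (mul D p (u, 0)) - smul A (\<Phi>0 p) u" for p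
  have v: "\<Phi> (v p, 0) = (\<Phi> p - \<Phi>0 p) * \<Phi> (u, 0)" if \<Phi>: "\<Phi> \<in> spectrum D" for \<Phi> p
  proof -
    have "(v p, 0) = mul D p (u, 0) - smul D (\<Phi>0 p) (u, 0)"
      by (cases p) (simp add: v_def duplication_simps)
    then show ?thesis by (simp add: D.character_simps[OF \<Phi>] left_diff_distrib)
  qed
  \<comment> \<open>If \<open>\<Phi> u\<close> is within \<open>1/2\<close> of \<open>1\<close>, dividing by it loses at most a factor \<open>2\<close>.\<close>
  define d where "d = min (e / 2) (1 / 2)"
  have d: "0 < d" using e by (simp add: d_def)
  have "finite (insert u (v ` X))" using X by simp
  from regularD[OF reg \<phi>0 this d]
  obtain c where c: "\<phi>0 c \<noteq> 0"
    "\<And>\<phi>. \<phi> \<in> spectrum A \<Longrightarrow> \<exists>x\<in>insert u (v ` X). d \<le> cmod (\<phi> x - \<phi>0 x) \<Longrightarrow> \<phi> c = 0"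
    by blast
  have "\<Phi> (c, 0) = 0" if \<Phi>: "\<Phi> \<in> spectrum D" and far: "\<exists>x\<in>X. e \<le> cmod (\<Phi> x - \<Phi>0 x)" for \<Phi>
  proof (cases "\<forall>a. \<Phi> (a, 0) = 0")
    case False
    then have \<phi>: "(\<lambda>a. \<Phi> (a, 0)) \<in> spectrum A" using restrict_left[OF \<Phi>] by blast
    obtain x where x: "x \<in> X" "e \<le> cmod (\<Phi> x - \<Phi>0 x)" using far by blast
    have "d \<le> cmod (\<Phi> (u, 0) - \<phi>0 u) \<or> d \<le> cmod (\<Phi> (v x, 0) - \<phi>0 (v x))"
    proof (rule disjCI)
      assume "\<not> d \<le> cmod (\<Phi> (v x, 0) - \<phi>0 (v x))"
      moreover have "\<phi>0 (v x) = 0" by (simp add: \<phi>0_def v[OF \<Phi>0])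
      ultimately have small: "cmod (\<Phi> x - \<Phi>0 x) * cmod (\<Phi> (u, 0)) < d"
        by (simp add: v[OF \<Phi>] norm_mult)
      have "cmod (\<Phi> (u, 0)) < 1 / 2"
      proof (rule ccontr)
        assume "\<not> ?thesis"
        then have "e * (1 / 2) \<le> cmod (\<Phi> x - \<Phi>0 x) * cmod (\<Phi> (u, 0))"
          using x(2) e by (intro mult_mono) auto
        with small show False by (simp add: d_def)
      qed
      then show "d \<le> cmod (\<Phi> (u, 0) - \<phi>0 u)"
        using norm_triangle_ineq2[of 1 "\<Phi> (u, 0)"] u by (simp add: d_def norm_minus_commute)
    qed
    then show ?thesis using x(1) by (intro c(2)[OF \<phi>]) auto
  qed simp
  moreover have "\<Phi>0 (c, 0) \<noteq> 0" using c(1) by (simp add: \<phi>0_def)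
  ultimately show ?thesis by blast
qed

text \<open>
  Let \<open>b\<close> separate the restriction \<open>\<psi>0\<close> of \<open>\<Phi>0\<close> to \<open>B\<close> from the
  characters of \<open>B\<close> that are far from it.  If \<open>\<Phi>\<close> is far from \<open>\<Phi>0\<close> and
  nevertheless \<open>\<Phi> b \<noteq> 0\<close>, then \<open>\<Phi>\<close> has modulus at least \<open>e / 2\<close> at the
  first component of one of the finitely many test elements.  Multiplying \<open>b\<close> by \<open>1 - u\<close> for the
  corresponding local units \<open>u\<close> kills these \<open>\<Phi>\<close> and does not change the value at
  \<open>\<Phi>0\<close>, which vanishes on \<open>A\<close>.
\<close>

lemma separate_right:
  assumes regA: "regular A" and regB: "regular B"
    and \<Phi>0: "\<Phi>0 \<in> spectrum D" and van: "\<And>a. \<Phi>0 (a, 0) = 0"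
    and X: "finite X" and e: "(0::real) < e"
  shows "\<exists>c. \<Phi>0 c \<noteq> 0 \<and> (\<forall>\<Phi>\<in>spectrum D. (\<exists>x\<in>X. e \<le> cmod (\<Phi> x - \<Phi>0 x)) \<longrightarrow> \<Phi> c = 0)"
proof -
  define \<psi>0 where "\<psi>0 b = \<Phi>0 (0, b)" for b
  have \<Phi>0_eq: "\<Phi>0 (a, b) = \<psi>0 b" for a b
    by (simp add: character_split[OF \<Phi>0, of a b] van \<psi>0_def)
  have "\<exists>b. \<psi>0 b \<noteq> 0"
    using D.character_nonzero[OF \<Phi>0] \<Phi>0_eq by (metis surj_pair zero_neq_one)
  then have \<psi>0: "\<psi>0 \<in> spectrum B" using restrict_right[OF \<Phi>0] unfolding \<psi>0_def by blast
  have e2: "0 < e / 2" using e by simp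
  from regularD[OF regB \<psi>0 finite_imageI[OF X, of snd] e2]
  obtain b where b: "\<psi>0 b \<noteq> 0"
    "\<And>\<psi>. \<psi> \<in> spectrum B \<Longrightarrow> \<exists>x\<in>snd ` X. e / 2 \<le> cmod (\<psi> x - \<psi>0 x) \<Longrightarrow> \<psi> b = 0"
    by blast
  have "\<exists>c. \<Phi>0 c \<noteq> 0 \<and> (\<forall>\<Phi>\<in>spectrum D.
      \<Phi> (0, b) = 0 \<or> (\<exists>x\<in>Y. e / 2 \<le> cmod (\<Phi> (fst x, 0))) \<longrightarrow> \<Phi> c = 0)"
    if "finite Y" for Y :: "('a \<times> 'b) set"
    using that
  proof (induction Y)
    case empty
    show ?case using b(1) by (intro exI[of _ "(0, b)"]) (simp add: \<Phi>0_eq)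
  next
    case (insert y Y)
    then obtain c where c: "\<Phi>0 c \<noteq> 0"
      "\<And>\<Phi>. \<Phi> \<in> spectrum D \<Longrightarrow> \<Phi> (0, b) = 0 \<or> (\<exists>x\<in>Y. e / 2 \<le> cmod (\<Phi> (fst x, 0))) \<Longrightarrow> \<Phi> c = 0"
      by blast
    obtain u where u: "\<And>\<phi>. \<phi> \<in> spectrum A \<Longrightarrow> e / 2 \<le> cmod (\<phi> (fst y)) \<Longrightarrow> \<phi> u = 1"
      using A.regular_local_unit[OF regA e2] by blast
    define c' where "c' = c - mul D (u, 0) c"
    have c': "\<Phi> c' = (1 - \<Phi> (u, 0)) * \<Phi> c" if "\<Phi> \<in> spectrum D" for \<Phi>
      by (simp add: c'_def D.character_simps[OF that] left_diff_distrib)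
    have "\<Phi> c' = 0" if \<Phi>: "\<Phi> \<in> spectrum D" and "e / 2 \<le> cmod (\<Phi> (fst y, 0))" for \<Phi>
    proof -
      have "(\<lambda>a. \<Phi> (a, 0)) \<in> spectrum A" using restrict_left[OF \<Phi>] that(2) e by auto
      from u[OF this that(2)] show ?thesis by (simp add: c'[OF \<Phi>])
    qed
    moreover have "\<Phi> c' = 0"
      if "\<Phi> \<in> spectrum D" "\<Phi> (0, b) = 0 \<or> (\<exists>x\<in>Y. e / 2 \<le> cmod (\<Phi> (fst x, 0)))" for \<Phi>
      using c(2)[OF that] c'[OF that(1)] by simp
    moreover have "\<Phi>0 c' \<noteq> 0" using c(1) by (simp add: c'[OF \<Phi>0] van)
    ultimately show ?case by (intro exI[of _ c']) blast
  qed
  from this[OF X] obtain c where c: "\<Phi>0 c \<noteq> 0"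
    "\<And>\<Phi>. \<Phi> \<in> spectrum D \<Longrightarrow> \<Phi> (0, b) = 0 \<or> (\<exists>x\<in>X. e / 2 \<le> cmod (\<Phi> (fst x, 0))) \<Longrightarrow> \<Phi> c = 0"
    by blast
  have "\<Phi> c = 0" if \<Phi>: "\<Phi> \<in> spectrum D" and far: "\<exists>x\<in>X. e \<le> cmod (\<Phi> x - \<Phi>0 x)" for \<Phi>
  proof -
    obtain p q where x: "(p, q) \<in> X" "e \<le> cmod (\<Phi> (p, q) - \<Phi>0 (p, q))" using far by auto
    have "\<Phi> (p, q) - \<Phi>0 (p, q) = \<Phi> (p, 0) + (\<Phi> (0, q) - \<psi>0 q)"
      by (simp add: character_split[OF \<Phi>, of p q] \<Phi>0_eq)
    then have "e \<le> cmod (\<Phi> (p, 0)) + cmod (\<Phi> (0, q) - \<psi>0 q)"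
      using x(2) norm_triangle_ineq[of "\<Phi> (p, 0)" "\<Phi> (0, q) - \<psi>0 q"] by simp
    then consider "e / 2 \<le> cmod (\<Phi> (p, 0))" | "e / 2 \<le> cmod (\<Phi> (0, q) - \<psi>0 q)" by linarith
    then show ?thesis
    proof cases
      case 1
      then show ?thesis using x(1) by (intro c(2)[OF \<Phi>]) force
    next
      case 2
      have "\<Phi> (0, b) = 0"
      proof (cases "\<forall>b. \<Phi> (0, b) = 0")
        case False
        then have "(\<lambda>b. \<Phi> (0, b)) \<in> spectrum B" using restrict_right[OF \<Phi>] by blast
        then show ?thesis using 2 x(1) by (intro b(2)) force+
      qed simp
      then show ?thesis by (intro c(2)[OF \<Phi>]) simp
    qed
  qed
  with c(1) show ?thesis by blast
qed

theorem regular_duplication: "regular D \<longleftrightarrow> regular A \<and> regular B"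
proof
  assume "regular D"
  then show "regular A \<and> regular B" using regular_left regular_right by blast
next
  assume AB: "regular A \<and> regular B"
  show "regular D" unfolding regular_iff
  proof (intro ballI allI impI, elim conjE)
    fix \<Phi>0 and X :: "('a \<times> 'b) set" and e :: real
    assume \<Phi>0: "\<Phi>0 \<in> spectrum D" and X: "finite X" and e: "0 < e"
    from restrict_left[OF \<Phi>0]
    show "\<exists>c. \<Phi>0 c \<noteq> 0 \<and> (\<forall>\<Phi>\<in>spectrum D. (\<exists>x\<in>X. e \<le> cmod (\<Phi> x - \<Phi>0 x)) \<longrightarrow> \<Phi> c = 0)"
    proof
      assume "(\<lambda>a. \<Phi>0 (a, 0)) \<in> spectrum A"
      with AB \<Phi>0 X e show ?thesis by (intro separate_left) auto
    next
      assume "\<forall>a. \<Phi>0 (a, 0) = 0"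
      with AB \<Phi>0 X e show ?thesis by (intro separate_right) auto
    qed
  qed
qed

end

theorem proposition3p9:
  fixes A :: "'a::ab_group_add alg" and B :: "'b::ab_group_add alg"
    and lact :: "'b \<Rightarrow> 'a \<Rightarrow> 'a" and ract :: "'a \<Rightarrow> 'b \<Rightarrow> 'a"
  assumes "comm_banach_algebra A" and "comm_banach_algebra B"
    and "banach_bimodule A B lact ract"
    and "symmetric_actions lact ract"
    and "compatible_actions A lact ract"
  shows "(semisimple (duplication A B lact ract) \<longleftrightarrow> semisimple A \<and> semisimple B) \<and>
         (regular (duplication A B lact ract) \<longleftrightarrow> regular A \<and> regular B)"
proof -
  interpret symmetric_banach_bimodule A B lact ract
    by (intro symmetric_banach_bimodule.intro symmetric_banach_bimodule_axioms.intro assms)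
  show ?thesis using semisimple_duplication regular_duplication by blast
qed

end
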